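(* Let $q\in\mathbb C$ with $q^N\neq 1$ for all $N\in\mathbb Z\setminus\{0\}$. Then the generating series $\mathcal R_{+,-}(\tau)$ and $\mathcal R_{-,+}(\tau)$ satisfy the differential equations $$\tau\frac{d\mathcal R_{+,-}(\tau)}{d\tau}=\mathcal R_{+,-}(\tau)\, I_{+,-}(\tau),\qquad \tau\frac{d\mathcal R_{-,+}(\tau)}{d\tau}=I_{-,+}(\tau)\,\mathcal R_{-,+}(\tau),$$ where $I_{\pm,\mp}(\tau)=\sum_{n>0}I^{(n)}_{\pm,\mp}\tau^n$ and $$I^{(n)}_{+,-}=\frac{(-1)^n(q^{-1}-q)}{[n]_q!\,[n-1]_q!}\oint\frac{dz}{2\pi i z}\,S_{f_0}^{\,n-1}\big(f_+(z)\big)\otimes S_{e_0}^{\,n-1}\big(e_-(z)\big),$$ $$I^{(n)}_{-,+}=\frac{(-1)^n(q^{-1}-q)}{[n]_q!\,[n-1]_q!}\oint\frac{dz}{2\pi i z}\,S_{f_0}^{\,n-1}\big(f_-(z)\big)\otimes S_{e_0}^{\,n-1}\big(e_+(z)\big).$$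
   Context: Fix $q\in\mathbb C$ with $q^N\neq1$ for all nonzero integers $N$. $U=U_q(\widehat{\mathfrak{sl}}_2)$ is the algebra (Drinfeld "new realization") generated by a central invertible element $q^{c}$, an element $d$, $k^{\pm1}$, $e_n,f_n$ ($n\in\mathbb Z$), $a_n$ ($n\in\mathbb Z\setminus\{0\}$), with generating series $e(z)=\sum_{n\in\mathbb Z}e_nz^{-n}$, $f(z)=\sum_{n\in\mathbb Z}f_nz^{-n}$, $\psi^\pm(z)=k^{\pm1}\exp\big(\pm(q-q^{-1})\sum_{n>0}a_{\pm n}z^{\mp n}\big)$, subject to: $x^de(z)x^{-d}=e(xz)$, $x^df(z)x^{-d}=f(xz)$, $x^d\psi^\pm(z)x^{-d}=\psi^\pm(xz)$; $(z-q^2w)e(z)e(w)=(q^2z-w)e(w)e(z)$; $(z-q^{-2}w)f(z)f(w)=(q^{-2}z-w)f(w)f(z)$; $\frac{q^{c/2}z-q^2w}{q^{2+c/2}z-w}\psi^+(z)e(w)=e(w)\psi^+(z)$; $\psi^-(z)e(w)=\frac{q^{2-c/2}z-w}{q^{-c/2}z-q^2w}e(w)\psi^-(z)$; $\frac{q^{-c/2}z-q^{-2}w}{q^{-2-c/2}z-w}\psi^+(z)f(w)=f(w)\psi^+(z)$; $\psi^-(z)f(w)=\frac{q^{-2+c/2}z-w}{q^{c/2}z-q^{-2}w}f(w)\psi^-(z)$; $\frac{(z-q^{2-c}w)(z-q^{-2+c}w)}{(q^{2+c}z-w)(q^{-2-c}z-w)}\psi^+(z)\psi^-(w)=\psi^-(w)\psi^+(z)$;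 $\psi^\pm(z)\psi^\pm(w)=\psi^\pm(w)\psi^\pm(z)$; $[e(z),f(w)]=\frac{1}{q-q^{-1}}\big(\delta(z/(q^cw))\psi^+(zq^{-c/2})-\delta(zq^c/w)\psi^-(wq^{-c/2})\big)$, with $\delta(z)=\sum_{n\in\mathbb Z}z^n$ (rational coefficients expanded in the region where the $\psi$-variable dominates for $\psi^+$ and is small for $\psi^-$). In particular $ke_nk^{-1}=q^2e_n$, $kf_nk^{-1}=q^{-2}f_n$. The counit satisfies $\varepsilon(e_n)=\varepsilon(f_n)=\varepsilon(a_n)=0$, $\varepsilon(k)=1$. Half-currents: $e_+(z)=\sum_{n\ge0}e_nz^{-n}$, $e_-(z)=-\sum_{n<0}e_nz^{-n}$, $f_+(z)=\sum_{n>0}f_nz^{-n}$, $f_-(z)=-\sum_{n\le0}f_nz^{-n}$ (so $e=e_+-e_-$, $f=f_+-f_-$). Screening operators (linear maps $U\to U$): $S_{e_0}(x)=e_0x-kxk^{-1}e_0$, $S_{f_0}(x)=xf_0-f_0kxk^{-1}$, applied coefficientwise to formal series. $q$-numbers: $[n]_q=\frac{q^n-q^{-n}}{q-q^{-1}}$, $[n]_q!=[1]_q\cdots[n]_q$, $[0]_q!=1$; $(a)_{q^2}=\frac{q^{2a}-1}{q^2-1}$, $\exp_{q^2}(x)=\sum_{n\ge0}x^n/(n)_{q^2}!$. $\oint\frac{dz}{2\pi i z}X(z)$ denotes the constant term in $z$ of a formal series $X(z)$. The elements $\mathcal R_{+,-}=\prod_{m=\infty}^{1}\exp_{q^2}\big((q^{-1}-q)f_m\otimes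 e_{-m}\big)$ (factors ordered with $m$ decreasing from left to right) and $\mathcal R_{-,+}=\prod_{n=0}^{\infty}\exp_{q^2}\big((q^{-1}-q)f_{-n}\otimes e_n\big)$ (factors ordered with $n$ increasing from left to right) lie in a completed tensor product $U\hat\otimes U$; they are the factors of the Drinfeld-comultiplication $R$-matrix part $\overline{\mathcal R}=\mathcal R_{+,-}\mathcal R_{-,+}$. For a formal variable $\tau$, $\mathcal R_{\pm,\mp}(\tau)=\tau^{-d_\alpha\otimes1}\mathcal R_{\pm,\mp}\tau^{d_\alpha\otimes1}$, where $d_\alpha$ is the grading with $[d_\alpha,e(z)]=e(z)$, $[d_\alpha,f(z)]=-f(z)$, $[d_\alpha,\psi^\pm(z)]=0$; equivalently $\mathcal R_{\pm,\mp}(\tau)=1\otimes1+\sum_{n>0}\mathcal R^{(n)}_{\pm,\mp}\tau^n$ where $\mathcal R^{(n)}_{\pm,\mp}$ is the component of $\mathcal R_{\pm,\mp}$ of degree $n$ in the generators $f_m$ of the first tensor factor. *)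

theory Defs
  imports Complex_Main
begin

text \<open>
  Encoding.  The algebra U = U_q(sl_2-hat) is presented by generators and relations.
  An identity in (a completion of) U (x) U holds iff it holds for every C-algebra B and
  every pair of mutually commuting families of elements of B each satisfying the defining
  relations of U (the images x(x)1 and 1(x)y; U(x)U itself is such a B).  We therefore
  work in an arbitrary ring B, made into a C-algebra by a unital ring homomorphism
  sc : complex => B with central image.
\<close>

definition C_alg :: "(complex \<Rightarrow> 'b::ring_1) \<Rightarrow> bool" where
  "C_alg sc \<longleftrightarrow> sc 1 = 1 \<and> (\<forall>x y. sc (x + y) = sc x + sc y) \<and>
     (\<forall>x y. sc (x * y) = sc x * sc y) \<and> (\<forall>x b. sc x * b = b * sc x)"

text \<open>Images of the generators: gam = q^(c/2), gami = q^(-c/2), d, k, k^-1,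
  e n, f n (n in Z), a n (n in Z, n \<noteq> 0; the value at 0 is ignored).\<close>
record 'b gens =
  gam  :: 'b
  gami :: 'b
  gd   :: 'b
  gk   :: 'b
  gki  :: 'b
  ge   :: "int \<Rightarrow> 'b"
  gf   :: "int \<Rightarrow> 'b"
  ga   :: "int \<Rightarrow> 'b"

definition comm :: "'b::ring \<Rightarrow> 'b \<Rightarrow> 'b" where
  "comm x y = x * y - y * x"

definition gpow :: "'b::ring_1 gens \<Rightarrow> int \<Rightarrow> 'b" where
  "gpow G n = (if 0 \<le> n then gam G ^ nat n else gami G ^ nat (- n))"

fun csum :: "(nat \<Rightarrow> 'b::ring_1) \<Rightarrow> nat \<Rightarrow> nat \<Rightarrow> 'b" where
  "csum a 0 N = (if N = 0 then 1 else 0)"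
| "csum a (Suc j) N = (\<Sum>n\<in>{1..N}. a n * csum a j (N - n))"

text \<open>psi^+(z) = sum_{i \<ge> 0} psip i z^(-i) = k exp((q-q^-1) sum_{n>0} a_n z^(-n));
  psi^-(z) = sum_{i \<ge> 0} psim i z^i = k^-1 exp(-(q-q^-1) sum_{n>0} a_(-n) z^n);
  both extended by 0 to negative indices.\<close>
definition psip :: "(complex \<Rightarrow> 'b::ring_1) \<Rightarrow> complex \<Rightarrow> 'b gens \<Rightarrow> int \<Rightarrow> 'b" where
  "psip sc q G i = (if i < 0 then 0 else
     gk G * (\<Sum>j\<le>nat i. sc ((q - inverse q) ^ j / of_nat (fact j))
                         * csum (\<lambda>n. ga G (int n)) j (nat i)))"

definition psim :: "(complex \<Rightarrow> 'b::ring_1) \<Rightarrow> complex \<Rightarrow> 'b gens \<Rightarrow> int \<Rightarrow> 'b" where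
  "psim sc q G i = (if i < 0 then 0 else
     gki G * (\<Sum>j\<le>nat i. sc ((- (q - inverse q)) ^ j / of_nat (fact j))
                         * csum (\<lambda>n. ga G (- int n)) j (nat i)))"

text \<open>The defining relations of U, written coefficientwise (rational coefficients cleared,
  which is equivalent in the stated expansion regions).  The relation
  x^d X(z) x^-d = X(xz) is written as [d, X_n] = -n X_n for X(z) = sum X_n z^(-n).\<close>
definition Uq_rels :: "(complex \<Rightarrow> 'b::ring_1) \<Rightarrow> complex \<Rightarrow> 'b gens \<Rightarrow> bool" where
  "Uq_rels sc q G \<longleftrightarrow>
    (let e = ge G; ps = psip sc q G; ph = psim sc q G;
         g = gam G; gi = gami G; k = gk G; ki = gki G; d = gd G; a = ga G;
         Q = (\<lambda>x. sc x); f = gf G in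
     \<comment> \<open>q^(c/2) central and invertible\<close>
     g * gi = 1 \<and> gi * g = 1 \<and>
     (\<forall>x \<in> {d, k, ki, gi}. g * x = x * g) \<and>
     (\<forall>n. g * e n = e n * g \<and> g * f n = f n * g) \<and>
     (\<forall>n. n \<noteq> 0 \<longrightarrow> g * a n = a n * g) \<and>
     \<comment> \<open>k invertible\<close>
     k * ki = 1 \<and> ki * k = 1 \<and>
     \<comment> \<open>grading element d\<close>
     (\<forall>n. comm d (e n) = - (of_int n * e n)) \<and>
     (\<forall>n. comm d (f n) = - (of_int n * f n)) \<and>
     (\<forall>i. comm d (ps i) = - (of_int i * ps i)) \<and>
     (\<forall>i. comm d (ph i) = of_int i * ph i) \<and>
     \<comment> \<open>(z - q^2 w) e(z)e(w) = (q^2 z - w) e(w)e(z)\<close>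
     (\<forall>r s. e (r+1) * e s - Q (q^2) * e r * e (s+1) = Q (q^2) * e s * e (r+1) - e (s+1) * e r) \<and>
     \<comment> \<open>(z - q^-2 w) f(z)f(w) = (q^-2 z - w) f(w)f(z)\<close>
     (\<forall>r s. f (r+1) * f s - Q (inverse q ^ 2) * f r * f (s+1)
            = Q (inverse q ^ 2) * f s * f (r+1) - f (s+1) * f r) \<and>
     \<comment> \<open>(q^(c/2) z - q^2 w) psi^+(z) e(w) = (q^(2+c/2) z - w) e(w) psi^+(z)\<close>
     (\<forall>i j. g * ps (i+1) * e j - Q (q^2) * ps i * e (j+1)
            = Q (q^2) * g * e j * ps (i+1) - e (j+1) * ps i) \<and>
     \<comment> \<open>(q^(-c/2) z - q^2 w) psi^-(z) e(w) = (q^(2-c/2) z - w) e(w) psi^-(z)\<close>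
     (\<forall>i j. gi * ph (i-1) * e j - Q (q^2) * ph i * e (j+1)
            = Q (q^2) * gi * e j * ph (i-1) - e (j+1) * ph i) \<and>
     \<comment> \<open>(q^(-c/2) z - q^-2 w) psi^+(z) f(w) = (q^(-2-c/2) z - w) f(w) psi^+(z)\<close>
     (\<forall>i j. gi * ps (i+1) * f j - Q (inverse q ^ 2) * ps i * f (j+1)
            = Q (inverse q ^ 2) * gi * f j * ps (i+1) - f (j+1) * ps i) \<and>
     \<comment> \<open>(q^(c/2) z - q^-2 w) psi^-(z) f(w) = (q^(-2+c/2) z - w) f(w) psi^-(z)\<close>
     (\<forall>i j. g * ph (i-1) * f j - Q (inverse q ^ 2) * ph i * f (j+1)
            = Q (inverse q ^ 2) * g * f j * ph (i-1) - f (j+1) * ph i) \<and>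
     \<comment> \<open>(z - q^(2-c) w)(z - q^(-2+c) w) psi^+(z)psi^-(w)
          = (q^(2+c) z - w)(q^(-2-c) z - w) psi^-(w)psi^+(z)\<close>
     (\<forall>i j. ps (i+2) * ph j - (Q (q^2) * gi^2 + Q (inverse q ^ 2) * g^2) * ps (i+1) * ph (j-1)
              + ps i * ph (j-2)
            = ph j * ps (i+2) - (Q (q^2) * g^2 + Q (inverse q ^ 2) * gi^2) * ph (j-1) * ps (i+1)
              + ph (j-2) * ps i) \<and>
     (\<forall>i j. ps i * ps j = ps j * ps i) \<and>
     (\<forall>i j. ph i * ph j = ph j * ph i) \<and>
     \<comment> \<open>[e(z), f(w)] = (delta(z/(q^c w)) psi^+(z q^(-c/2)) - delta(z q^c/w) psi^-(w q^(-c/2)))/(q-q^-1)\<close>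
     (\<forall>r s. comm (e r) (f s)
            = Q (inverse (q - inverse q)) * (ps (r+s) * gpow G (r-s) - ph (-r-s) * gpow G (s-r))))"

definition gens_commute :: "'b::ring_1 gens \<Rightarrow> 'b gens \<Rightarrow> bool" where
  "gens_commute G H \<longleftrightarrow>
    (let gen = (\<lambda>X. {gam X, gami X, gd X, gk X, gki X} \<union> range (ge X) \<union> range (gf X)
                     \<union> ga X ` {n. n \<noteq> 0}) in
     \<forall>x \<in> gen G. \<forall>y \<in> gen H. x * y = y * x)"

definition qint :: "complex \<Rightarrow> nat \<Rightarrow> complex" where
  "qint q n = (q ^ n - inverse q ^ n) / (q - inverse q)"
definition qfact :: "complex \<Rightarrow> nat \<Rightarrow> complex" where
  "qfact q n = (\<Prod>i\<in>{1..n}. qint q i)"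
definition q2int :: "complex \<Rightarrow> nat \<Rightarrow> complex" where
  "q2int q a = (q ^ (2 * a) - 1) / (q ^ 2 - 1)"
definition q2fact :: "complex \<Rightarrow> nat \<Rightarrow> complex" where
  "q2fact q n = (\<Prod>i\<in>{1..n}. q2int q i)"

definition S_e0 :: "'b::ring_1 gens \<Rightarrow> 'b \<Rightarrow> 'b" where
  "S_e0 G x = ge G 0 * x - gk G * x * gki G * ge G 0"
definition S_f0 :: "'b::ring_1 gens \<Rightarrow> 'b \<Rightarrow> 'b" where
  "S_f0 G x = x * gf G 0 - gf G 0 * gk G * x * gki G"

text \<open>Half-currents, as coefficient functions n \<mapsto> coefficient of z^(-n).\<close>
definition e_plus :: "'b::ring_1 gens \<Rightarrow> int \<Rightarrow> 'b" where
  "e_plus G n = (if 0 \<le> n then ge G n else 0)"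
definition e_minus :: "'b::ring_1 gens \<Rightarrow> int \<Rightarrow> 'b" where
  "e_minus G n = (if n < 0 then - ge G n else 0)"
definition f_plus :: "'b::ring_1 gens \<Rightarrow> int \<Rightarrow> 'b" where
  "f_plus G n = (if 0 < n then gf G n else 0)"
definition f_minus :: "'b::ring_1 gens \<Rightarrow> int \<Rightarrow> 'b" where
  "f_minus G n = (if n \<le> 0 then - gf G n else 0)"

text \<open>An element of the completion is represented by its homogeneous components
  X n k: n = tau-degree (number of f-generators in the first factor),
  k = absolute value of the d-degree of the first factor (f_m has d-degree -m;
  k = m for R_{+,-}, I_{+,-} and k = -m for R_{-,+}, I_{-,+}).  A component with
  first factor x and second factor y is represented by x1 * y2 in B, x1, y2 the images
  under the two commuting copies.  Multiplication is the Cauchy product.\<close>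
type_synonym 'b cser = "nat \<Rightarrow> nat \<Rightarrow> 'b"

definition cmul :: "'b::ring_1 cser \<Rightarrow> 'b cser \<Rightarrow> 'b cser" where
  "cmul X Y n k = (\<Sum>i\<le>n. \<Sum>j\<le>k. X i j * Y (n - i) (k - j))"

definition cone :: "'b::ring_1 cser" where
  "cone n k = (if n = 0 \<and> k = 0 then 1 else 0)"

text \<open>exp_{q^2}((q^-1 - q) x (x) y) where x (x) y has bidegree (1, m).\<close>
definition qexp_factor :: "(complex \<Rightarrow> 'b::ring_1) \<Rightarrow> complex \<Rightarrow> nat \<Rightarrow> 'b \<Rightarrow> 'b \<Rightarrow> 'b cser" where
  "qexp_factor sc q m x y n k =
     (if k = n * m then sc ((inverse q - q) ^ n / q2fact q n) * x ^ n * y ^ n else 0)"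

fun Rpm_part :: "(complex \<Rightarrow> 'b::ring_1) \<Rightarrow> complex \<Rightarrow> 'b gens \<Rightarrow> 'b gens \<Rightarrow> nat \<Rightarrow> 'b cser" where
  "Rpm_part sc q G H 0 = cone"
| "Rpm_part sc q G H (Suc M) =
     cmul (qexp_factor sc q (Suc M) (gf G (int (Suc M))) (ge H (- int (Suc M))))
          (Rpm_part sc q G H M)"

fun Rmp_part :: "(complex \<Rightarrow> 'b::ring_1) \<Rightarrow> complex \<Rightarrow> 'b gens \<Rightarrow> 'b gens \<Rightarrow> nat \<Rightarrow> 'b cser" where
  "Rmp_part sc q G H 0 = qexp_factor sc q 0 (gf G 0) (ge H 0)"
| "Rmp_part sc q G H (Suc M) =
     cmul (Rmp_part sc q G H M)
          (qexp_factor sc q (Suc M) (gf G (- int (Suc M))) (ge H (int (Suc M))))"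

text \<open>The infinite ordered products: the (n,k)-component stabilises once all factors
  of mode index > k are included (those factors are 1 in degree \<le> k).\<close>
definition R_pm :: "(complex \<Rightarrow> 'b::ring_1) \<Rightarrow> complex \<Rightarrow> 'b gens \<Rightarrow> 'b gens \<Rightarrow> 'b cser" where
  "R_pm sc q G H n k = Rpm_part sc q G H k n k"
definition R_mp :: "(complex \<Rightarrow> 'b::ring_1) \<Rightarrow> complex \<Rightarrow> 'b gens \<Rightarrow> 'b gens \<Rightarrow> 'b cser" where
  "R_mp sc q G H n k = Rmp_part sc q G H k n k"

definition Icoef :: "complex \<Rightarrow> nat \<Rightarrow> complex" where
  "Icoef q n = (-1) ^ n * (inverse q - q) / (qfact q n * qfact q (n - 1))"

text \<open>I^(n) = c_n * const.term of S_f0^(n-1)(X(z)) (x) S_e0^(n-1)(Y(z)), with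
  X(z) = sum x_m z^-m, Y(z) = sum y_m z^-m: the constant term is sum_m x_m (x) y_(-m);
  its term with index m lies in mode degree k = m (for +,-) resp. k = -m (for -,+).\<close>
definition I_pm :: "(complex \<Rightarrow> 'b::ring_1) \<Rightarrow> complex \<Rightarrow> 'b gens \<Rightarrow> 'b gens \<Rightarrow> 'b cser" where
  "I_pm sc q G H n k = (if n = 0 then 0 else
     sc (Icoef q n) * ((S_f0 G ^^ (n - 1)) (f_plus G (int k))
                       * (S_e0 H ^^ (n - 1)) (e_minus H (- int k))))"
definition I_mp :: "(complex \<Rightarrow> 'b::ring_1) \<Rightarrow> complex \<Rightarrow> 'b gens \<Rightarrow> 'b gens \<Rightarrow> 'b cser" where
  "I_mp sc q G H n k = (if n = 0 then 0 else
     sc (Icoef q n) * ((S_f0 G ^^ (n - 1)) (f_minus G (- int k))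
                       * (S_e0 H ^^ (n - 1)) (e_plus H (int k))))"

end

theory Submission
  imports Defs "HOL-Computational_Algebra.Formal_Power_Series"
begin

text \<open>
  Let \<open>E\<^sub>a\<close> be the q-exponential factor of the pair \<open>(f\<^sub>a, e\<^sub>-\<^sub>a)\<close>, \<open>\<theta> = \<tau> d/d\<tau>\<close>, and \<open>I\<^sub>a\<close> the
  analogue of \<open>I\<^sub>+\<^sub>,\<^sub>-\<close> built from the modes \<open>\<ge> a\<close> and screened by \<open>f\<close>, \<open>e\<close> of index \<open>a - 1\<close>, \<open>1 - a\<close>.
  The key identity is \<open>E\<^sub>a I\<^sub>a = I\<^sub>a\<^sub>+\<^sub>1 E\<^sub>a + \<theta> E\<^sub>a\<close>.  It telescopes to \<open>\<theta> P = P I\<^sub>1 - I\<^sub>M\<^sub>+\<^sub>1 P\<close>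
  for \<open>P = E\<^sub>M \<dots> E\<^sub>1\<close>, and \<open>I\<^sub>M\<^sub>+\<^sub>1\<close> vanishes in mode degree \<open>\<le> M\<close>.

  By the quadratic relations, screening by the mode \<open>a - 1\<close> on the right agrees, up to a sign and a
  shift of modes, with screening by the mode \<open>a\<close> on the left; hence \<open>I\<^sub>a\<close> and \<open>I\<^sub>a\<^sub>+\<^sub>1\<close> are both
  expressible through \<open>f\<^sub>a\<close>, \<open>e\<^sub>-\<^sub>a\<close>.  The key identity then says that a polynomial in commuting
  operators is invariant under exchanging left and right multiplications.  This is the coefficientwise
  form of Heine's transformation
  \<open>\<^sub>2\<phi>\<^sub>1(px, py; p\<^sup>2; \<tau>) (\<tau>; p)\<^sub>\<infinity> = \<^sub>2\<phi>\<^sub>1(p/x, p/y; p\<^sup>2; xy\<tau>) (xy\<tau>; p)\<^sub>\<infinity>\<close> with \<open>p = q\<^sup>2\<close>, and follows from a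
  symmetric three-term recurrence satisfied by both sides.
\<close>

section \<open>Bigraded components as iterated power series\<close>

unbundle fps_syntax

text \<open>The outer variable is tau and the inner one records the mode degree. The Cauchy product
  \<open>cmul\<close> becomes multiplication in a ring, so ring laws apply.\<close>

definition cfps :: "'b::ring_1 cser \<Rightarrow> 'b fps fps" where
  "cfps X = Abs_fps (\<lambda>n. Abs_fps (X n))"

lemma cfps_nth [simp]: "cfps X $ n $ k = X n k"
  by (simp add: cfps_def)

lemma fps_fps_mult_nth:
  "(A * B) $ n $ k = (\<Sum>i\<le>n. \<Sum>j\<le>k. A $ i $ j * B $ (n - i) $ (k - j))"
  by (simp add: fps_mult_nth fps_sum_nth atLeast0AtMost)

lemma cfps_cmul: "cfps (cmul X Y) = cfps X * cfps Y"
  by (intro fps_ext) (simp add: fps_fps_mult_nth cmul_def)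

lemma cfps_cone: "cfps cone = 1"
  by (intro fps_ext) (simp add: cone_def fps_one_nth)

text \<open>The scalar map is a parameter because the theory is used twice: over \<open>'b\<close>
  itself and, through the interpretation \<open>fps\<close>, over power series with coefficients in
  \<open>'b\<close>.\<close>

locale q_algebra =
  fixes q :: complex and sc :: "complex \<Rightarrow> 'b::ring_1"
  assumes q_nonzero: "q \<noteq> 0"
    and q_generic: "0 < n \<Longrightarrow> q ^ (2 * n) \<noteq> 1"
    and C_alg: "C_alg sc"
begin

lemma sc_1 [simp]: "sc 1 = 1"
  and sc_add: "sc (x + y) = sc x + sc y"
  and sc_mult: "sc (x * y) = sc x * sc y"
  and sc_central: "b * sc x = sc x * b"
  using C_alg unfolding C_alg_def by metis+

lemma sc_0 [simp]: "sc 0 = 0"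
  using sc_add[of 0 0] by simp

lemma sc_minus: "sc (- x) = - sc x"
  using sc_add[of x "- x"] by (simp add: eq_neg_iff_add_eq_0 add.commute)

lemma sc_diff: "sc (x - y) = sc x - sc y"
  using sc_add[of x "- y"] by (simp add: sc_minus)

lemma sc_of_nat: "sc (of_nat n) = of_nat n"
  by (induction n) (simp_all add: sc_add)

lemma sc_scale: "sc a * (sc b * x) = sc (a * b) * x"
  by (simp add: sc_mult mult.assoc)

lemma sc_cancel:
  assumes "a \<noteq> 0" "sc a * x = sc a * y"
  shows "x = y"
proof -
  have "sc (inverse a * a) * x = sc (inverse a * a) * y"
    using assms(2) by (simp only: sc_mult mult.assoc)
  thus ?thesis using assms by simp
qed

section \<open>Scalars and coefficient recursions\<close>

definition p :: complex where "p = q ^ 2"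
definition r :: complex where "r = inverse q ^ 2"
text \<open>The constant that the recursions \<open>eps_Suc\<close> and \<open>gam_Suc\<close> have
  in common.\<close>

definition lam :: complex where "lam = (inverse q - q) * (1 - p)"
definition eps :: "nat \<Rightarrow> complex" where "eps n = (inverse q - q) ^ n / q2fact q n"
text \<open>The coefficient of \<open>I\<^sup>(\<^sup>m\<^sup>+\<^sup>1\<^sup>)\<close>, including the factors by which the iterated \<open>S\<^sub>e\<^sub>0\<close> differs from
  \<open>screen_right\<close>.\<close>
definition gam_coef :: "nat \<Rightarrow> complex" where
  "gam_coef m = Icoef q (Suc m) * (\<Prod>i = 1..m. - (p ^ i))"

lemma p_generic: "p ^ Suc n \<noteq> 1"
  using q_generic[of "Suc n"] by (metis p_def power_mult zero_less_Suc)

lemma pr: "p * r = 1"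
  by (simp add: p_def r_def q_nonzero power_inverse)

lemma pr_power: "p ^ n * r ^ n = 1"
  by (simp add: pr flip: power_mult_distrib)

lemma p_not_1: "p \<noteq> 1"
  using p_generic[of 0] by simp

lemma eps_0 [simp]: "eps 0 = 1"
  by (simp add: eps_def q2fact_def)

lemma q2int_eq: "q2int q n = (p ^ n - 1) / (p - 1)"
  by (simp add: q2int_def p_def power_mult)

lemma eps_Suc: "(1 - p ^ Suc n) * eps (Suc n) = lam * eps n"
proof -
  define A where "A = q2int q (Suc n)"
  have "A \<noteq> 0"
    unfolding A_def q2int_eq using p_generic[of n] p_not_1 by simp
  moreover have A: "1 - p ^ Suc n = (1 - p) * A"
    unfolding A_def q2int_eq using p_not_1 by (simp add: field_simps)
  moreover have "q2fact q (Suc n) = q2fact q n * A"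
    by (simp add: q2fact_def A_def)
  ultimately show ?thesis
    unfolding eps_def lam_def A by simp
qed

lemma q_ne_inverse: "q - inverse q \<noteq> 0"
proof
  assume "q - inverse q = 0"
  hence "q * q = 1" using q_nonzero by (simp add: field_simps)
  thus False using q_generic[of 1] by (simp add: power2_eq_square)
qed

lemma qint_eq: "qint q n * (q - inverse q) * q ^ n = p ^ n - 1"
proof -
  have "qint q n * (q - inverse q) = q ^ n - inverse q ^ n"
    using q_ne_inverse by (simp add: qint_def)
  hence "qint q n * (q - inverse q) * q ^ n = q ^ n * q ^ n - (inverse q * q) ^ n"
    by (simp add: left_diff_distrib power_mult_distrib)
  thus ?thesis
    using q_nonzero by (simp add: p_def flip: power_add power_mult mult_2)
qed

lemma qint_nonzero: "qint q (Suc n) \<noteq> 0"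
  using qint_eq[of "Suc n"] p_generic[of n] by auto

lemma qfact_nonzero: "qfact q n \<noteq> 0"
  by (induction n) (simp_all add: qfact_def qint_nonzero)

lemma gam_0: "gam_coef 0 = - (inverse q - q)"
  using q_ne_inverse by (simp add: gam_coef_def Icoef_def qfact_def qint_def)

text \<open>The ratio of consecutive coefficients is rational in \<open>p ^ m\<close>, as for a
  basic hypergeometric series. One factor \<open>p ^ (m + 1)\<close> comes from the product in
  \<open>gam_coef\<close>, the other from clearing the two new q-integers of
  \<open>Icoef\<close>.\<close>

lemma gam_Suc:
  "(1 - p ^ (m + 2)) * (1 - p ^ (m + 1)) * gam_coef (Suc m) = lam * p ^ (2 * m + 2) * gam_coef m"
proof -
  define A B where "A = qint q (m + 2)" and "B = qint q (m + 1)"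
  have nz: "A \<noteq> 0" "B \<noteq> 0" using qint_nonzero by (auto simp: A_def B_def)
  have A: "A * (q - inverse q) * q ^ (m + 2) = p ^ (m + 2) - 1"
    and B: "B * (q - inverse q) * q ^ (m + 1) = p ^ (m + 1) - 1"
    unfolding A_def B_def by (rule qint_eq)+
  have I: "Icoef q (Suc (Suc m)) * (A * B) = - Icoef q (Suc m)"
    using nz qfact_nonzero[of m] unfolding A_def B_def Icoef_def
    by (simp add: qfact_def)
  have "(1 - p ^ (m + 2)) * (1 - p ^ (m + 1)) = (p ^ (m + 2) - 1) * (p ^ (m + 1) - 1)"
    by algebra
  also have "\<dots> = A * B * ((q - inverse q) ^ 2 * q ^ (2 * m + 3))"
    unfolding A[symmetric] B[symmetric] by (simp add: power_add power2_eq_square numeral_eq_Suc)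
  finally have 1: "(1 - p ^ (m + 2)) * (1 - p ^ (m + 1)) = A * B * ((q - inverse q) ^ 2 * q ^ (2 * m + 3))" .
  have q3: "q ^ (2 * m + 3) = p ^ (m + 1) * q"
    unfolding p_def power_mult[symmetric] by (simp add: numeral_3_eq_3)
  have lam: "lam = (q - inverse q) ^ 2 * q"
    using q_nonzero by (simp add: lam_def p_def field_simps power2_eq_square)
  have g: "gam_coef (Suc m) * (A * B) = p ^ (m + 1) * gam_coef m"
  proof -
    have "gam_coef (Suc m) * (A * B)
        = - (Icoef q (Suc (Suc m)) * (A * B)) * (\<Prod>i = 1..m. - (p ^ i)) * p ^ (m + 1)"
      unfolding gam_coef_def by (simp add: mult_ac)
    thus ?thesis unfolding I gam_coef_def by (simp add: mult_ac)
  qed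
  have "(1 - p ^ (m + 2)) * (1 - p ^ (m + 1)) * gam_coef (Suc m)
     = (gam_coef (Suc m) * (A * B)) * ((q - inverse q) ^ 2 * q ^ (2 * m + 3))"
    unfolding 1 by (simp only: mult_ac)
  also have "\<dots> = lam * (p ^ (m + 1) * p ^ (m + 1)) * gam_coef m"
    unfolding g q3 lam by (simp only: mult_ac)
  also have "p ^ (m + 1) * p ^ (m + 1) = p ^ (2 * m + 2)"
    by (simp flip: power_add add: mult_2)
  finally show ?thesis by (simp only: mult_ac)
qed

subsection \<open>A terminating form of Heine's transformation\<close>

definition sc_linear :: "('b \<Rightarrow> 'b) \<Rightarrow> bool" where
  "sc_linear Z \<longleftrightarrow> (\<forall>x y. Z (x + y) = Z x + Z y) \<and> (\<forall>c x. Z (sc c * x) = sc c * Z x)"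

lemma sc_linear_0: "sc_linear Z \<Longrightarrow> Z 0 = 0"
  unfolding sc_linear_def by (metis mult_zero_left sc_0)

lemma sc_linear_add: "sc_linear Z \<Longrightarrow> Z (x + y) = Z x + Z y"
  and sc_linear_scale: "sc_linear Z \<Longrightarrow> Z (sc c * x) = sc c * Z x"
  unfolding sc_linear_def by blast+

lemma sc_linear_diff: "sc_linear Z \<Longrightarrow> Z (x - y) = Z x - Z y"
  using sc_linear_add[of Z "x - y" y] by (simp add: eq_diff_eq)

lemma sc_linear_sum: "sc_linear Z \<Longrightarrow> Z (\<Sum>i\<in>I. g i) = (\<Sum>i\<in>I. Z (g i))"
  by (induction I rule: infinite_finite_induct) (simp_all add: sc_linear_0 sc_linear_add)

lemma sc_linear_funpow: "sc_linear Z \<Longrightarrow> sc_linear (Z ^^ n)"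
  by (induction n) (simp_all add: sc_linear_def)

text \<open>For \<open>Z = LL'\<close>, \<open>W = RR'\<close> and \<open>S = LR' + RL'\<close> the factors are \<open>(L - r\<^sup>i R)(L' - r\<^sup>i R')\<close>.\<close>
primrec op_product :: "('b \<Rightarrow> 'b) \<Rightarrow> ('b \<Rightarrow> 'b) \<Rightarrow> ('b \<Rightarrow> 'b) \<Rightarrow> nat \<Rightarrow> 'b \<Rightarrow> 'b" where
  "op_product Z W S 0 x = x"
| "op_product Z W S (Suc j) x = Z (op_product Z W S j x) - sc (r ^ Suc j) * S (op_product Z W S j x)
     + sc (r ^ (2 * Suc j)) * W (op_product Z W S j x)"

text \<open>Up to sign, the coefficient of tau^(N+1) in the product of the q-exponential with a
  generator series, with left and right multiplications replaced by abstract operators.\<close>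

definition mixed_sum :: "('b \<Rightarrow> 'b) \<Rightarrow> ('b \<Rightarrow> 'b) \<Rightarrow> ('b \<Rightarrow> 'b) \<Rightarrow> 'b \<Rightarrow> nat \<Rightarrow> 'b" where
  "mixed_sum Z W S x N = (\<Sum>m\<le>N. sc (gam_coef m * eps (N - m)) * (Z ^^ (N - m)) (op_product Z W S m x))"

definition op_triple :: "('b \<Rightarrow> 'b) \<Rightarrow> ('b \<Rightarrow> 'b) \<Rightarrow> ('b \<Rightarrow> 'b) \<Rightarrow> bool" where
  "op_triple Z W S \<longleftrightarrow> sc_linear Z \<and> sc_linear W \<and> sc_linear S \<and>
     (\<forall>x. Z (W x) = W (Z x)) \<and> (\<forall>x. Z (S x) = S (Z x)) \<and> (\<forall>x. W (S x) = S (W x))"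

lemma op_triple_swap: "op_triple Z W S \<Longrightarrow> op_triple W Z S"
  by (auto simp: op_triple_def)

text \<open>The scalar on the left splits into a part that lowers the index of \<open>eps\<close>
  and a part that lowers the index of \<open>gam_coef\<close>. Both leave the weight
  \<open>gam_coef m * eps (M - m)\<close>, and the recursion of \<open>op_product\<close> turns the
  remaining operators into \<open>Z\<close>, \<open>W\<close> and \<open>S\<close>. The last sum is
  a correction of lower order.\<close>

lemma mixed_sum_rec_gen:
  fixes Z W S :: "'b \<Rightarrow> 'b" and x :: 'b
  assumes "op_triple Z W S"
  defines "A \<equiv> \<lambda>i m. (Z ^^ i) (op_product Z W S m x)"
  shows "sc ((1 - p ^ (M + 2)) * (1 - p ^ (M + 1))) * mixed_sum Z W S x (Suc M)
    = sc lam * (Z (mixed_sum Z W S x M) + W (mixed_sum Z W S x M)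
        - sc (p ^ (M + 1)) * S (mixed_sum Z W S x M))
      - sc lam * (\<Sum>m\<le>M. sc (gam_coef m * eps (M - m) * (1 - p ^ (M - m))) * W (A (M - m) m))"
proof -
  have lin: "sc_linear Z" "sc_linear W" "sc_linear S"
    and ZW: "Z (W y) = W (Z y)" and ZS: "Z (S y) = S (Z y)" for y
    using assms(1) by (auto simp: op_triple_def)
  have ZWi: "(Z ^^ i) (W y) = W ((Z ^^ i) y)" and ZSi: "(Z ^^ i) (S y) = S ((Z ^^ i) y)" for i y
    by (induction i) (simp_all add: ZW ZS)
  have ZA: "Z (A i m) = A (Suc i) m" for i m by (simp add: A_def)
  note lini = sc_linear_funpow[OF lin(1)]
  have ASuc: "A i (Suc m) = A (Suc i) m - sc (r ^ Suc m) * S (A i m) + sc (r ^ (2 * Suc m)) * W (A i m)"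
    for i m
    unfolding A_def
    by (simp add: sc_linear_add[OF lini] sc_linear_diff[OF lini] sc_linear_scale[OF lini] ZWi ZSi
        del: power_Suc) (simp add: funpow_swap1)
  \<comment> \<open>The recursion of \<open>op_product\<close> is solved for its \<open>S\<close>
    term, using that \<open>p\<close> and \<open>r\<close> are inverse.\<close>
  have SA: "S (A i m) = sc (p ^ Suc m) * A (Suc i) m + sc (r ^ Suc m) * W (A i m)
      - sc (p ^ Suc m) * A i (Suc m)" for i m
  proof -
    have e: "p ^ Suc m * r ^ (2 * Suc m) = r ^ Suc m"
      using pr_power[of "Suc m"] unfolding mult_2 power_add by (metis mult.assoc mult.left_neutral)
    have "sc (p ^ Suc m) * A i (Suc m)
        = sc (p ^ Suc m) * A (Suc i) m - S (A i m) + sc (r ^ Suc m) * W (A i m)"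
      unfolding ASuc by (simp only: distrib_left right_diff_distrib sc_scale pr_power e sc_1 mult_1)
    thus ?thesis by simp
  qed
  have mixed_sum: "mixed_sum Z W S x N = (\<Sum>m\<le>N. sc (gam_coef m * eps (N - m)) * A (N - m) m)" for N
    by (simp add: mixed_sum_def A_def)
  define K where "K = (1 - p ^ (M + 2)) * (1 - p ^ (M + 1))"
  \<comment> \<open>With X = p^(M+1-m) and Y = p^m, the splitting is (1-pXY)(1-XY) = (1-X)(1-pXYY) +
    X(1-pY)(1-Y). The first summand vanishes at m = M+1 and the second at m = 0, so the index shifts
    leave no boundary terms.\<close>
  define g1 where "g1 m = gam_coef m * (1 - p ^ (Suc M - m)) * (1 - p ^ (M + m + 2)) * eps (Suc M - m)" for m
  define g2 where "g2 m = p ^ (Suc M - m) * (1 - p ^ (m + 1)) * (1 - p ^ m) * gam_coef m * eps (Suc M - m)" for m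
  have Kg: "K * (gam_coef m * eps (Suc M - m)) = g1 m + g2 m" if "m \<le> Suc M" for m
  proof -
    define a where "a = Suc M - m"
    have a: "M + 1 = a + m" using that by (simp add: a_def)
    have M1: "p ^ (M + 1) = p ^ a * p ^ m"
      unfolding a by (rule power_add)
    have M2: "p ^ (M + 2) = p * (p ^ a * p ^ m)" "p ^ (M + m + 2) = p * (p ^ a * p ^ m * p ^ m)"
      unfolding M1[symmetric] by (simp_all add: power_add mult_ac)
    have d: "Suc M - m = a" by (simp add: a_def)
    show ?thesis
      unfolding K_def g1_def g2_def M1 M2 d by (simp add: algebra_simps)
  qed
  have g1: "g1 m = lam * (gam_coef m * eps (M - m)) * (1 - p ^ (M + m + 2))" if "m \<le> M" for m
    using eps_Suc[of "M - m"] that unfolding g1_def by (simp add: Suc_diff_le mult_ac del: power_Suc)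
  have g2: "g2 (Suc m) = lam * (gam_coef m * eps (M - m)) * p ^ (M + m + 2)" if "m \<le> M" for m
  proof -
    have "g2 (Suc m) = ((1 - p ^ (m + 2)) * (1 - p ^ (m + 1)) * gam_coef (Suc m)) * p ^ (M - m) * eps (M - m)"
      unfolding g2_def by (simp add: mult_ac)
    also have "\<dots> = lam * (gam_coef m * eps (M - m)) * (p ^ (2 * m + 2) * p ^ (M - m))"
      unfolding gam_Suc by (simp only: mult_ac)
    also have "p ^ (2 * m + 2) * p ^ (M - m) = p ^ (M + m + 2)"
      using that by (simp flip: power_add add: ac_simps)
    finally show ?thesis .
  qed
  have "sc K * mixed_sum Z W S x (Suc M)
      = (\<Sum>m\<le>Suc M. sc (g1 m) * A (Suc M - m) m) + (\<Sum>m\<le>Suc M. sc (g2 m) * A (Suc M - m) m)"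
    unfolding mixed_sum sum_distrib_left sum.distrib[symmetric]
    by (intro sum.cong refl) (simp add: sc_scale Kg sc_add distrib_right del: sum.atMost_Suc)
  also have "(\<Sum>m\<le>Suc M. sc (g1 m) * A (Suc M - m) m)
      = (\<Sum>m\<le>M. sc (lam * (gam_coef m * eps (M - m)) * (1 - p ^ (M + m + 2))) * A (Suc (M - m)) m)"
    by (simp add: g1 Suc_diff_le) (simp add: g1_def)
  also have "(\<Sum>m\<le>Suc M. sc (g2 m) * A (Suc M - m) m)
      = (\<Sum>m\<le>M. sc (lam * (gam_coef m * eps (M - m)) * p ^ (M + m + 2)) * A (M - m) (Suc m))"
    unfolding sum.atMost_Suc_shift by (simp add: g2) (simp add: g2_def)
  finally have L: "sc K * mixed_sum Z W S x (Suc M) = (\<Sum>m\<le>M. sc lam * (sc (gam_coef m * eps (M - m)) *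
      (sc (1 - p ^ (M + m + 2)) * A (Suc (M - m)) m + sc (p ^ (M + m + 2)) * A (M - m) (Suc m))))"
    by (simp only: sum.distrib distrib_left sc_scale mult.assoc)
  have P: "p ^ (M + 1) * p ^ Suc m = p ^ (M + m + 2)" for m
    by (simp add: power_add mult_ac)
  have R: "p ^ (M + 1) * r ^ Suc m = p ^ (M - m)" if "m \<le> M" for m
  proof -
    have "M + 1 = (M - m) + Suc m" using that by simp
    thus ?thesis by (metis power_add pr_power mult.assoc mult.right_neutral)
  qed
  have "A (Suc (M - m)) m + W (A (M - m) m) - sc (p ^ (M + 1)) * S (A (M - m) m)
        - sc (1 - p ^ (M - m)) * W (A (M - m) m)
      = sc (1 - p ^ (M + m + 2)) * A (Suc (M - m)) m + sc (p ^ (M + m + 2)) * A (M - m) (Suc m)"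
    if "m \<le> M" for m
    unfolding SA right_diff_distrib distrib_left sc_scale P R[OF that]
    by (simp add: sc_diff algebra_simps)
  hence "sc K * mixed_sum Z W S x (Suc M) = (\<Sum>m\<le>M. sc lam * (sc (gam_coef m * eps (M - m)) *
     (A (Suc (M - m)) m + W (A (M - m) m) - sc (p ^ (M + 1)) * S (A (M - m) m)
        - sc (1 - p ^ (M - m)) * W (A (M - m) m))))"
    unfolding L by (intro sum.cong refl) simp
  also have "\<dots> = sc lam * (Z (mixed_sum Z W S x M) + W (mixed_sum Z W S x M)
        - sc (p ^ (M + 1)) * S (mixed_sum Z W S x M))
      - sc lam * (\<Sum>m\<le>M. sc (gam_coef m * eps (M - m) * (1 - p ^ (M - m))) * W (A (M - m) m))"
    unfolding mixed_sum sc_linear_sum[OF lin(1)] sc_linear_sum[OF lin(2)] sc_linear_sum[OF lin(3)]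
    unfolding sum_distrib_left sum.distrib[symmetric] sum_subtractf[symmetric]
    by (intro sum.cong refl)
      (simp only: sc_linear_scale[OF lin(1)] sc_linear_scale[OF lin(2)] sc_linear_scale[OF lin(3)]
        ZA right_diff_distrib distrib_left sc_scale mult_ac)
  finally show ?thesis unfolding K_def .
qed

text \<open>For \<open>M = 0\<close> the correction sum is a single term with the factor
  \<open>1 - p ^ 0\<close>.\<close>

lemma mixed_sum_rec_1:
  assumes "op_triple Z W S"
  shows "sc ((1 - p ^ 2) * (1 - p)) * mixed_sum Z W S x (Suc 0)
    = sc lam * (Z (mixed_sum Z W S x 0) + W (mixed_sum Z W S x 0) - sc p * S (mixed_sum Z W S x 0))"
  using mixed_sum_rec_gen[OF assms, of 0 x] by (simp add: power2_eq_square)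

text \<open>The right-hand side is symmetric in \<open>Z\<close> and \<open>W\<close>, although the definition of \<open>mixed_sum\<close> is not.\<close>
lemma mixed_sum_rec:
  assumes "op_triple Z W S"
  shows "sc ((1 - p ^ (N + 3)) * (1 - p ^ (N + 2))) * mixed_sum Z W S x (Suc (Suc N))
    = sc lam * (Z (mixed_sum Z W S x (Suc N)) + W (mixed_sum Z W S x (Suc N))
        - sc (p ^ (N + 2)) * S (mixed_sum Z W S x (Suc N)))
      - sc (lam ^ 2) * Z (W (mixed_sum Z W S x N))"
proof -
  have lin: "sc_linear Z" "sc_linear W" and ZW: "Z (W y) = W (Z y)" for y
    using assms(1) by (auto simp: op_triple_def)
  have e: "eps (Suc m) * (1 - p ^ Suc m) = lam * eps m" for m
    using eps_Suc[of m] by (simp add: mult_ac del: power_Suc)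
  \<comment> \<open>The factor \<open>1 - p ^ (Suc N - m)\<close> kills the top term and lowers
    \<open>eps\<close> in the others, each of which keeps one surplus \<open>Z\<close>.\<close>
  have "(\<Sum>m\<le>Suc N. sc (gam_coef m * eps (Suc N - m) * (1 - p ^ (Suc N - m))) *
            W ((Z ^^ (Suc N - m)) (op_product Z W S m x)))
      = (\<Sum>m\<le>N. sc (gam_coef m * (lam * eps (N - m))) * W (Z ((Z ^^ (N - m)) (op_product Z W S m x))))"
    by (simp add: mult.assoc e Suc_diff_le del: power_Suc)
  also have "\<dots> = sc lam * Z (W (mixed_sum Z W S x N))"
    unfolding mixed_sum_def sc_linear_sum[OF lin(1)] sc_linear_sum[OF lin(2)] sum_distrib_left ZW
    by (intro sum.cong refl) (simp add: lin sc_linear_scale sc_scale mult_ac)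
  finally have sum: "(\<Sum>m\<le>Suc N. sc (gam_coef m * eps (Suc N - m) * (1 - p ^ (Suc N - m))) *
            W ((Z ^^ (Suc N - m)) (op_product Z W S m x))) = sc lam * Z (W (mixed_sum Z W S x N))" .
  have n: "Suc N + 2 = N + 3" "Suc N + 1 = N + 2" by simp_all
  show ?thesis
    using mixed_sum_rec_gen[OF assms, of "Suc N" x] unfolding sum n sc_scale power2_eq_square .
qed

text \<open>The leading scalars are nonzero because \<open>p\<close> is not a root of unity. Leaving
  \<open>U\<close> and \<open>V\<close> arbitrary lets the lemma serve both the symmetry and the
  closed form on powers.\<close>

lemma three_term_unique:
  assumes "F 0 = G 0"
    and "\<And>F'. F' = F \<or> F' = G \<Longrightarrow>
      sc ((1 - p ^ 2) * (1 - p)) * F' (Suc 0) = U (F' 0)"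
    and "\<And>F' N. F' = F \<or> F' = G \<Longrightarrow>
      sc ((1 - p ^ (N + 3)) * (1 - p ^ (N + 2))) * F' (Suc (Suc N)) = V N (F' (Suc N)) (F' N)"
  shows "F N = G N"
proof (induction N rule: less_induct)
  case (less N)
  consider "N = 0" | "N = Suc 0" | M where "N = Suc (Suc M)"
    by (metis not0_implies_Suc)
  thus ?case
  proof cases
    case 1 thus ?thesis using assms(1) by simp
  next
    case 2
    have "(1 - p ^ 2) * (1 - p) \<noteq> 0"
      using p_generic[of 0] p_generic[of 1] by (simp add: numeral_2_eq_2)
    moreover have "sc ((1 - p ^ 2) * (1 - p)) * F N = sc ((1 - p ^ 2) * (1 - p)) * G N"
      unfolding 2 using assms(2)[of F] assms(2)[of G] assms(1) by metis
    ultimately show ?thesis by (rule sc_cancel)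
  next
    case 3
    have "(1 - p ^ (M + 3)) * (1 - p ^ (M + 2)) \<noteq> 0"
      using p_generic[of "M + 2"] p_generic[of "M + 1"] by (simp add: numeral_eq_Suc)
    moreover have "sc ((1 - p ^ (M + 3)) * (1 - p ^ (M + 2))) * F N
        = sc ((1 - p ^ (M + 3)) * (1 - p ^ (M + 2))) * G N"
      unfolding 3 using assms(3)[of F M] assms(3)[of G M] less[of M] less[of "Suc M"] 3 by simp
    ultimately show ?thesis by (rule sc_cancel)
  qed
qed

text \<open>Both sequences start at \<open>gam_coef 0\<close> times \<open>x\<close>, and
  \<open>Z\<close>, \<open>W\<close> enter the recurrence only through their sum and their
  product.\<close>

lemma mixed_sum_swap:
  assumes "op_triple Z W S"
  shows "mixed_sum Z W S x N = mixed_sum W Z S x N"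
proof (rule three_term_unique)
  show "mixed_sum Z W S x 0 = mixed_sum W Z S x 0" by (simp add: mixed_sum_def)
next
  fix F' assume F': "F' = mixed_sum Z W S x \<or> F' = mixed_sum W Z S x"
  show "sc ((1 - p ^ 2) * (1 - p)) * F' (Suc 0) = sc lam * (Z (F' 0) + W (F' 0) - sc p * S (F' 0))"
    using F' mixed_sum_rec_1[OF assms, of x] mixed_sum_rec_1[OF op_triple_swap[OF assms], of x]
    by (auto simp: add.commute)
  fix N
  have "Z (W y) = W (Z y)" for y using assms by (simp add: op_triple_def)
  thus "sc ((1 - p ^ (N + 3)) * (1 - p ^ (N + 2))) * F' (Suc (Suc N))
      = sc lam * (Z (F' (Suc N)) + W (F' (Suc N)) - sc (p ^ (N + 2)) * S (F' (Suc N)))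
       - sc (lam ^ 2) * Z (W (F' N))"
    using F' mixed_sum_rec[OF assms, of N x] mixed_sum_rec[OF op_triple_swap[OF assms], of N x]
    by (auto simp: add.commute)
qed

text \<open>On powers of \<open>y\<close> the operators \<open>Z\<close> and \<open>W\<close> agree
  and \<open>S\<close> is twice either, so the recurrence becomes scalar. The factor
  \<open>Suc N\<close> is what later produces tau d/dtau of the q-exponential.\<close>

lemma mixed_sum_diagonal:
  assumes "op_triple Z W S" and W: "\<And>i. W (y ^ Suc i) = y ^ Suc (Suc i)"
    and Z: "\<And>i. Z (y ^ Suc i) = y ^ Suc (Suc i)" and S: "\<And>i. S (y ^ Suc i) = 2 * y ^ Suc (Suc i)"
  shows "mixed_sum Z W S y N = - (sc (of_nat (Suc N) * eps (Suc N)) * y ^ Suc N)"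
proof -
  have lin: "sc_linear Z" "sc_linear W" "sc_linear S" using assms(1) by (auto simp: op_triple_def)
  define G where "G N = sc (- (of_nat (Suc N) * eps (Suc N))) * y ^ Suc N" for N
  define U where "U = (\<lambda>t. sc lam * (Z t + W t - sc p * S t))"
  define V where "V = (\<lambda>N t s. sc lam * (Z t + W t - sc (p ^ (N + 2)) * S t) - sc (lam ^ 2) * Z (W s))"
  have two: "2 * z = sc 2 * z" for z using sc_of_nat[of 2] by simp
  have collect: "sc a * z + sc b * z = sc (a + b) * z" "sc a * z - sc b * z = sc (a - b) * z" for a b z
    by (simp_all add: sc_add sc_diff distrib_right left_diff_distrib)
  have eps1: "eps (Suc 0) = inverse q - q"
    using p_not_1 by (simp add: eps_def q2fact_def q2int_eq)
  have UG: "U (sc c * y ^ Suc i) = sc (lam * c * (2 - 2 * p)) * y ^ Suc (Suc i)" for c i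
    unfolding U_def
    by (simp only: lin sc_linear_scale Z W S two sc_scale collect) (simp add: algebra_simps power2_eq_square)
  have VG: "V N (sc c * y ^ Suc (Suc i)) (sc d * y ^ Suc i)
      = sc (lam * c * (2 - 2 * p ^ (N + 2)) - lam ^ 2 * d) * y ^ Suc (Suc (Suc i))" for c d i N
    unfolding V_def
    by (simp only: lin sc_linear_scale Z W S two sc_scale collect) (simp add: algebra_simps power2_eq_square)
  have "mixed_sum Z W S y N = G N"
  proof (rule three_term_unique[where U = U and V = V])
    show "mixed_sum Z W S y 0 = G 0"
      by (simp add: mixed_sum_def gam_0 G_def eps1)
  next
    fix F' assume F': "F' = mixed_sum Z W S y \<or> F' = G"
    have e2: "(1 - p ^ 2) * eps (Suc (Suc 0)) = lam * eps (Suc 0)"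
      using eps_Suc[of "Suc 0"] by (simp add: power2_eq_square)
    have "(1 - p ^ 2) * (1 - p) * - (of_nat 2 * eps (Suc (Suc 0))) = - (2 * (1 - p)) * ((1 - p ^ 2) * eps (Suc (Suc 0)))"
      by (simp add: algebra_simps)
    also have "\<dots> = lam * - (of_nat 1 * eps (Suc 0)) * (2 - 2 * p)"
      unfolding e2 by (simp add: algebra_simps)
    finally have "sc ((1 - p ^ 2) * (1 - p)) * G (Suc 0) = U (G 0)"
      unfolding G_def UG sc_scale by (simp add: numeral_2_eq_2 mult.commute)
    thus "sc ((1 - p ^ 2) * (1 - p)) * F' (Suc 0) = U (F' 0)"
      using F' mixed_sum_rec_1[OF assms(1), of y] by (auto simp: U_def)
    fix N
    have e2: "(1 - p ^ (N + 2)) * eps (N + 2) = lam * eps (N + 1)"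
      and e3: "(1 - p ^ (N + 3)) * eps (N + 3) = lam * eps (N + 2)"
      using eps_Suc[of "Suc N"] eps_Suc[of "Suc (Suc N)"] by (simp_all add: numeral_eq_Suc)
    have "(1 - p ^ (N + 3)) * (1 - p ^ (N + 2)) * - (of_nat (N + 3) * eps (N + 3))
        = - of_nat (N + 3) * (1 - p ^ (N + 2)) * ((1 - p ^ (N + 3)) * eps (N + 3))"
      by (simp only: mult_ac mult_minus_left mult_minus_right)
    \<comment> \<open>Here N+3 is written as 2(N+2) - (N+1), which matches the two terms of
      \<open>V\<close>.\<close>
    also have "\<dots> = lam * - (of_nat (N + 2) * eps (N + 2)) * (2 - 2 * p ^ (N + 2))
         + lam * of_nat (N + 1) * ((1 - p ^ (N + 2)) * eps (N + 2))"
      unfolding e3 by (simp add: algebra_simps)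
    also have "\<dots> = lam * - (of_nat (N + 2) * eps (N + 2)) * (2 - 2 * p ^ (N + 2))
         - lam ^ 2 * - (of_nat (N + 1) * eps (N + 1))"
      unfolding e2 by (simp add: power2_eq_square)
    finally have "sc ((1 - p ^ (N + 3)) * (1 - p ^ (N + 2))) * G (Suc (Suc N)) = V N (G (Suc N)) (G N)"
      unfolding G_def VG sc_scale by (simp add: numeral_eq_Suc)
    thus "sc ((1 - p ^ (N + 3)) * (1 - p ^ (N + 2))) * F' (Suc (Suc N)) = V N (F' (Suc N)) (F' N)"
      using F' mixed_sum_rec[OF assms(1), of N y] by (auto simp: V_def)
  qed
  thus ?thesis by (simp add: G_def sc_minus)
qed

subsection \<open>The q-exponential as an intertwiner\<close>

definition left_product :: "'b \<Rightarrow> 'b \<Rightarrow> nat \<Rightarrow> 'b \<Rightarrow> 'b" where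
  "left_product f e = op_product (\<lambda>x. f * e * x) (\<lambda>x. x * (f * e)) (\<lambda>x. f * x * e + e * x * f)"

definition right_product :: "'b \<Rightarrow> 'b \<Rightarrow> nat \<Rightarrow> 'b \<Rightarrow> 'b" where
  "right_product f e = op_product (\<lambda>x. x * (f * e)) (\<lambda>x. f * e * x) (\<lambda>x. f * x * e + e * x * f)"

lemma sc_left_commute: "b * (sc c * x) = sc c * (b * x)"
  by (simp add: sc_central flip: mult.assoc)

lemma op_triple_mult:
  assumes "f * e = e * f"
  shows "op_triple (\<lambda>x. f * e * x) (\<lambda>x. x * (f * e)) (\<lambda>x. f * x * e + e * x * f)"
proof -
  have e: "e * (f * x) = f * (e * x)" for x
    using assms by (metis mult.assoc)
  show ?thesis
    unfolding op_triple_def sc_linear_def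
    by (simp add: algebra_simps sc_left_commute assms e)
qed

lemma left_product_add: "left_product f e j (x + y) = left_product f e j x + left_product f e j y"
  and right_product_add: "right_product f e j (x + y) = right_product f e j x + right_product f e j y"
  by (induction j) (simp_all add: left_product_def right_product_def algebra_simps)

lemma left_product_0: "left_product f e j 0 = 0" and right_product_0: "right_product f e j 0 = 0"
  by (induction j) (simp_all add: left_product_def right_product_def)

definition qexp :: "'b \<Rightarrow> 'b fps" where
  "qexp y = Abs_fps (\<lambda>n. sc (eps n) * y ^ n)"
text \<open>The index shift reflects that the n-th generator carries n-1 screenings. The minus sign
  is that of the one negative half-current in each pairing.\<close>

definition left_series :: "'b \<Rightarrow> 'b \<Rightarrow> 'b \<Rightarrow> 'b fps" where
  "left_series f e w = Abs_fps (\<lambda>n. case n of 0 \<Rightarrow> 0 | Suc j \<Rightarrow> - (sc (gam_coef j) * left_product f e j w))"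
definition right_series :: "'b \<Rightarrow> 'b \<Rightarrow> 'b \<Rightarrow> 'b fps" where
  "right_series f e w = Abs_fps (\<lambda>n. case n of 0 \<Rightarrow> 0 | Suc j \<Rightarrow> - (sc (gam_coef j) * right_product f e j w))"
definition theta :: "'b fps \<Rightarrow> 'b fps" where
  "theta F = Abs_fps (\<lambda>n. of_nat n * F $ n)"

lemma theta_mult: "theta (F * G) = theta F * G + F * theta G"
proof (rule fps_ext)
  fix n
  have c: "of_nat m * x = x * of_nat m" for m and x :: 'b
    by (rule mult_of_nat_commute)
  have "theta (F * G) $ n = (\<Sum>i=0..n. of_nat n * (F $ i * G $ (n - i)))"
    by (simp add: theta_def fps_mult_nth sum_distrib_left)
  also have "\<dots> = (\<Sum>i=0..n. of_nat i * F $ i * G $ (n - i) + F $ i * (of_nat (n - i) * G $ (n - i)))"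
  proof (intro sum.cong refl)
    fix i assume "i \<in> {0..n}"
    hence "of_nat n = (of_nat i + of_nat (n - i) :: 'b)" by (simp flip: of_nat_add)
    moreover have "F $ i * (of_nat (n - i) * G $ (n - i)) = of_nat (n - i) * (F $ i * G $ (n - i))"
      by (metis c mult.assoc)
    ultimately show "of_nat n * (F $ i * G $ (n - i))
        = of_nat i * F $ i * G $ (n - i) + F $ i * (of_nat (n - i) * G $ (n - i))"
      by (simp add: distrib_right mult.assoc)
  qed
  also have "\<dots> = (theta F * G + F * theta G) $ n"
    by (simp add: theta_def fps_mult_nth sum.distrib mult.assoc)
  finally show "theta (F * G) $ n = (theta F * G + F * theta G) $ n" .
qed

lemma qexp_left_series_nth:
  "(qexp (f * e) * left_series f e w) $ Suc N
    = - mixed_sum (\<lambda>x. f * e * x) (\<lambda>x. x * (f * e)) (\<lambda>x. f * x * e + e * x * f) w N"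
proof -
  define Q where "Q = qexp (f * e)"
  define T where "T = left_series f e w"
  have pow: "((\<lambda>x. f * e * x) ^^ n) x = (f * e) ^ n * x" for n x
    by (induction n) (simp_all add: mult.assoc)
  have "(Q * T) $ Suc N = (\<Sum>i\<le>Suc N. Q $ i * T $ (Suc N - i))"
    by (simp add: fps_mult_nth atLeast0AtMost)
  also have "\<dots> = (\<Sum>i\<le>N. Q $ i * T $ Suc (N - i))"
    by (simp add: T_def left_series_def Suc_diff_le)
  also have "\<dots> = (\<Sum>i\<le>N. Q $ (N - i) * T $ Suc (N - (N - i)))"
    using sum.nat_diff_reindex[of "\<lambda>i. Q $ i * T $ Suc (N - i)" "Suc N"] by (simp only: lessThan_Suc_atMost diff_Suc_Suc)
  also have "\<dots> = (\<Sum>i\<le>N. - (sc (gam_coef i * eps (N - i)) * ((f * e) ^ (N - i) * left_product f e i w)))"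
    by (intro sum.cong refl)
      (simp add: Q_def T_def qexp_def left_series_def sc_left_commute[of "(f * e) ^ n" for n] sc_scale mult.assoc
        mult.commute[of "eps n" for n])
  finally show ?thesis
    by (simp add: Q_def T_def mixed_sum_def pow left_product_def sum_negf)
qed

lemma right_series_qexp_nth:
  "(right_series f e w * qexp (f * e)) $ Suc N
    = - mixed_sum (\<lambda>x. x * (f * e)) (\<lambda>x. f * e * x) (\<lambda>x. f * x * e + e * x * f) w N"
proof -
  have pow: "((\<lambda>x. x * (f * e)) ^^ n) x = x * (f * e) ^ n" for n x
    by (induction n) (simp_all add: mult.assoc power_commutes)
  have "(right_series f e w * qexp (f * e)) $ Suc N
      = (\<Sum>i\<le>Suc N. right_series f e w $ i * qexp (f * e) $ (Suc N - i))"
    by (simp add: fps_mult_nth atLeast0AtMost)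
  also have "\<dots> = (\<Sum>i\<le>N. - (sc (gam_coef i * eps (N - i)) * (right_product f e i w * (f * e) ^ (N - i))))"
    unfolding sum.atMost_Suc_shift
    by (simp add: qexp_def right_series_def) (intro sum.cong refl,
      simp add: mult.assoc sc_left_commute[of "right_product f e m w" for m] sc_scale)
  finally show ?thesis
    by (simp add: mixed_sum_def pow right_product_def sum_negf)
qed

text \<open>Powers of \<open>f * e\<close> acting from the left and from the right are iterates of
  \<open>Z\<close> and of \<open>W\<close>. The coefficients of the two sides are therefore mixed
  sums with \<open>Z\<close> and \<open>W\<close> exchanged.\<close>

lemma qexp_intertwines:
  assumes "f * e = e * f"
  shows "qexp (f * e) * left_series f e w = right_series f e w * qexp (f * e)"
proof (rule fps_ext)
  fix n show "(qexp (f * e) * left_series f e w) $ n = (right_series f e w * qexp (f * e)) $ n"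
    using mixed_sum_swap[OF op_triple_mult[OF assms]]
    by (cases n) (simp_all add: qexp_left_series_nth right_series_qexp_nth, simp add: left_series_def right_series_def)
qed

lemma qexp_left_series_self:
  assumes "f * e = e * f"
  shows "qexp (f * e) * left_series f e (f * e) = theta (qexp (f * e))"
proof (rule fps_ext)
  fix n
  have comm: "e * (f * e) ^ i = (f * e) ^ i * e" "f * (f * e) ^ i = (f * e) ^ i * f" for i
    using assms by (metis mult.assoc power_commuting_commutes)+
  have diag: "(f * e) ^ Suc i * (f * e) = (f * e) ^ Suc (Suc i)"
    "f * e * (f * e) ^ Suc i = (f * e) ^ Suc (Suc i)" for i
    by (simp_all only: power_Suc power_commutes mult.assoc)
  have S: "f * (f * e) ^ i * e + e * (f * e) ^ i * f = 2 * (f * e) ^ Suc i" for i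
    unfolding comm mult.assoc assms[symmetric] by (simp flip: power_Suc2 mult_2)
  show "(qexp (f * e) * left_series f e (f * e)) $ n = theta (qexp (f * e)) $ n"
  proof (cases n)
    case 0 thus ?thesis by (simp add: left_series_def theta_def)
  next
    case (Suc N)
    have "(qexp (f * e) * left_series f e (f * e)) $ n = sc (of_nat (Suc N) * eps (Suc N)) * (f * e) ^ Suc N"
      unfolding Suc qexp_left_series_nth mixed_sum_diagonal[OF op_triple_mult[OF assms] diag S] by simp
    thus ?thesis
      unfolding Suc theta_def qexp_def by (simp only: fps_nth_Abs_fps sc_mult sc_of_nat mult.assoc)
  qed
qed

lemma left_series_add: "left_series f e (w + w') = left_series f e w + left_series f e w'"
  and right_series_add: "right_series f e (w + w') = right_series f e w + right_series f e w'"
  by (rule fps_ext; simp add: left_series_def right_series_def left_product_add right_product_add distrib_left split: nat.split)+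

text \<open>In the application \<open>f * e\<close> is the pair of the lowest mode and
  \<open>w\<close> collects the higher ones: \<open>w\<close> is merely intertwined, while
  \<open>f * e\<close> contributes the derivative.\<close>

lemma qexp_step_left:
  assumes "f * e = e * f"
  shows "qexp (f * e) * left_series f e (w + f * e) = right_series f e w * qexp (f * e) + theta (qexp (f * e))"
  by (simp add: left_series_add distrib_left qexp_intertwines[OF assms, of w] qexp_left_series_self[OF assms])

lemma qexp_step_right:
  assumes "f * e = e * f"
  shows "right_series f e (w + f * e) * qexp (f * e) = qexp (f * e) * left_series f e w + theta (qexp (f * e))"
  using qexp_intertwines[OF assms, of w] qexp_intertwines[OF assms, of "f * e"] qexp_left_series_self[OF assms]
  by (simp add: right_series_add distrib_right)

subsection \<open>Screening operators and the quadratic relations\<close>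

text \<open>Starting from weight \<open>r\<close>, an element screened \<open>j\<close> times by
  \<open>f_0\<close> has weight \<open>r ^ Suc j\<close> under conjugation by \<open>k\<close>.
  Inserting this weight into \<open>S_f0\<close> removes \<open>k\<close> from the formula.\<close>

primrec screen_right :: "'b \<Rightarrow> nat \<Rightarrow> 'b \<Rightarrow> 'b" where
  "screen_right b 0 x = x"
| "screen_right b (Suc j) x = screen_right b j x * b - sc (r ^ Suc j) * (b * screen_right b j x)"

primrec screen_left :: "'b \<Rightarrow> nat \<Rightarrow> 'b \<Rightarrow> 'b" where
  "screen_left b 0 x = x"
| "screen_left b (Suc j) x = b * screen_left b j x - sc (r ^ Suc j) * (screen_left b j x * b)"

lemma screen_right_commute: "x * e = e * x \<Longrightarrow> f * e = e * f \<Longrightarrow> screen_right f j x * e = e * screen_right f j x"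
  and screen_left_commute: "x * e = e * x \<Longrightarrow> f * e = e * f \<Longrightarrow> screen_left f j x * e = e * screen_left f j x"
proof (induction j)
  case (Suc j)
  {
    case 1
    note c = "Suc.IH"(1)[OF 1] 1(2)
    hence "screen_right f j x * (f * e) = e * (screen_right f j x * f)"
      "f * (screen_right f j x * e) = e * (f * screen_right f j x)"
      by (metis mult.assoc)+
    thus ?case by (simp add: algebra_simps sc_left_commute del: power_Suc)
  next
    case 2
    note c = "Suc.IH"(2)[OF 2] 2(2)
    hence "screen_left f j x * (f * e) = e * (screen_left f j x * f)"
      "f * (screen_left f j x * e) = e * (f * screen_left f j x)"
      by (metis mult.assoc)+
    thus ?case by (simp add: algebra_simps sc_left_commute del: power_Suc)
  }
qed auto

text \<open>As the two families commute, the screenings act on the product \<open>x * y\<close> as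
  R_f - r^i L_f and R_e - r^i L_e, with L and R the left and right multiplications. Their composite
  expands to one step of \<open>op_product\<close>.\<close>

lemma screen_right_mult:
  assumes "x * e = e * x" "y * f = f * y" "f * e = e * f"
  shows "screen_right f j x * screen_right e j y = right_product f e j (x * y)"
proof (induction j)
  case (Suc j)
  define X where "X = screen_right f j x"
  define Y where "Y = screen_right e j y"
  have X: "X * e = e * X" and Y: "Y * f = f * Y"
    using assms screen_right_commute[of x e f j] screen_right_commute[of y f e j] by (auto simp: X_def Y_def)
  have m': "f * (e * z) = e * (f * z)" "X * (e * z) = e * (X * z)" for z
    using assms(3) X by (metis mult.assoc)+
  have m: "f * (Y * z) = Y * (f * z)" for z using Y by (metis mult.assoc)
  have r2: "r ^ (2 * Suc j) = r ^ Suc j * r ^ Suc j" by (simp only: mult_2 power_add)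
  have XY: "X * f * (Y * e) = X * Y * (f * e)" "X * f * (e * Y) = e * (X * Y) * f"
    "f * X * (Y * e) = f * (X * Y) * e" "f * X * (e * Y) = f * e * (X * Y)"
    by (simp add: mult.assoc m, simp add: mult.assoc m' Y, simp add: mult.assoc, simp add: mult.assoc m')
  have "screen_right f (Suc j) x * screen_right e (Suc j) y
      = X * f * (Y * e) - sc (r ^ Suc j) * (X * f * (e * Y)) - (sc (r ^ Suc j) * (f * X * (Y * e))
        - sc (r ^ (2 * Suc j)) * (f * X * (e * Y)))"
    by (simp only: screen_right.simps X_def[symmetric] Y_def[symmetric] left_diff_distrib right_diff_distrib
        mult.assoc sc_left_commute[of X] sc_left_commute[of Y] sc_left_commute[of f]
        sc_left_commute[of e] sc_scale r2) (simp add: algebra_simps)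
  also have "\<dots> = X * Y * (f * e) - sc (r ^ Suc j) * (f * (X * Y) * e + e * (X * Y) * f)
      + sc (r ^ (2 * Suc j)) * (f * e * (X * Y))"
    unfolding XY by (simp only: distrib_left) simp
  finally show ?case
    using Suc.IH by (simp add: right_product_def X_def Y_def)
qed (simp add: right_product_def)

lemma screen_left_mult:
  assumes "x * e = e * x" "y * f = f * y" "f * e = e * f"
  shows "screen_left f j x * screen_left e j y = left_product f e j (x * y)"
proof (induction j)
  case (Suc j)
  define X where "X = screen_left f j x"
  define Y where "Y = screen_left e j y"
  have X: "X * e = e * X" and Y: "Y * f = f * Y"
    using assms screen_left_commute[of x e f j] screen_left_commute[of y f e j] by (auto simp: X_def Y_def)
  have m': "f * (e * z) = e * (f * z)" "X * (e * z) = e * (X * z)" for z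
    using assms(3) X by (metis mult.assoc)+
  have m: "f * (Y * z) = Y * (f * z)" for z using Y by (metis mult.assoc)
  have r2: "r ^ (2 * Suc j) = r ^ Suc j * r ^ Suc j" by (simp only: mult_2 power_add)
  have XY: "X * f * (Y * e) = X * Y * (f * e)" "X * f * (e * Y) = e * (X * Y) * f"
    "f * X * (Y * e) = f * (X * Y) * e" "f * X * (e * Y) = f * e * (X * Y)"
    by (simp add: mult.assoc m, simp add: mult.assoc m' Y, simp add: mult.assoc, simp add: mult.assoc m')
  have "screen_left f (Suc j) x * screen_left e (Suc j) y
      = f * X * (e * Y) - sc (r ^ Suc j) * (f * X * (Y * e)) - (sc (r ^ Suc j) * (X * f * (e * Y))
        - sc (r ^ (2 * Suc j)) * (X * f * (Y * e)))"
    by (simp only: screen_left.simps X_def[symmetric] Y_def[symmetric] left_diff_distrib right_diff_distrib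
        mult.assoc sc_left_commute[of X] sc_left_commute[of Y] sc_left_commute[of f]
        sc_left_commute[of e] sc_scale r2) (simp add: algebra_simps)
  also have "\<dots> = f * e * (X * Y) - sc (r ^ Suc j) * (f * (X * Y) * e + e * (X * Y) * f)
      + sc (r ^ (2 * Suc j)) * (X * Y * (f * e))"
    unfolding XY by (simp only: distrib_left) simp
  finally show ?case
    using Suc.IH by (simp add: left_product_def X_def Y_def)
qed (simp add: left_product_def)

text \<open>Satisfied by the modes \<open>f\<^sub>i\<close> and, after the reflection \<open>i \<mapsto> -i\<close>, by the modes \<open>e\<^sub>i\<close>.\<close>
definition quadratic_rel :: "(int \<Rightarrow> 'b) \<Rightarrow> bool" where
  "quadratic_rel g \<longleftrightarrow> (\<forall>i s. g (i + 1) * g s - sc r * g i * g (s + 1) = sc r * g s * g (i + 1) - g (s + 1) * g i)"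

text \<open>For equal indices the two sides of the relation are negatives of each other, and the
  scalar 2 is invertible.\<close>

lemma quadratic_rel_adjacent:
  assumes "quadratic_rel g"
  shows "g (b + 1) * g b = sc r * (g b * g (b + 1))"
proof -
  define u where "u = g (b + 1) * g b"
  define v where "v = sc r * g b * g (b + 1)"
  have "u - v = v - u"
    using assms unfolding quadratic_rel_def u_def v_def by blast
  hence "sc 2 * u = sc 2 * v"
    using sc_of_nat[of 2] by (simp add: mult_2 algebra_simps)
  hence "u = v" by (rule sc_cancel[rotated]) simp
  thus ?thesis by (simp add: u_def v_def mult.assoc)
qed

lemma quadratic_rel_power:
  assumes "quadratic_rel g"
  shows "g (b + 1) ^ n * g b = sc (r ^ n) * (g b * g (b + 1) ^ n)"
    and "g (b + 1) * g b ^ n = sc (r ^ n) * (g b ^ n * g (b + 1))"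
proof -
  note a = quadratic_rel_adjacent[OF assms, of b]
  have a2: "g (b + 1) * (g b * z) = sc r * (g b * (g (b + 1) * z))" for z
    by (simp only: a flip: mult.assoc)
  show "g (b + 1) ^ n * g b = sc (r ^ n) * (g b * g (b + 1) ^ n)"
  proof (induction n)
    case (Suc n)
    show ?case
      by (simp only: power_Suc mult.assoc Suc sc_left_commute[of "g (b + 1)"])
         (simp only: a2 sc_scale mult.commute[of r])
  qed simp
  show "g (b + 1) * g b ^ n = sc (r ^ n) * (g b ^ n * g (b + 1))"
  proof (induction n)
    case (Suc n)
    have 1: "g (b + 1) * g b ^ Suc n = g (b + 1) * g b ^ n * g b"
      by (simp add: mult.assoc power_commutes)
    show ?case
      unfolding 1 Suc
      by (simp only: mult.assoc a sc_left_commute[of "g b ^ n"] sc_scale power_Suc2)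
  qed simp
qed

text \<open>For \<open>j = 0\<close> this is the quadratic relation. In the induction step,
  \<open>g (b + 1)\<close> and \<open>g b\<close> commute up to the scalar \<open>r\<close>, so the
  twisted commutator with \<open>g (b + 1)\<close> passes through the one with
  \<open>g b\<close>.\<close>

lemma screen_left_step_screen_right:
  assumes "quadratic_rel g"
  shows "g (b + 1) * screen_right (g b) j (g m) - sc (r ^ Suc j) * (screen_right (g b) j (g m) * g (b + 1))
      = - screen_right (g b) (Suc j) (g (m + 1))"
proof (induction j)
  case 0
  have "g (b + 1) * g m - sc r * g b * g (m + 1) = sc r * g m * g (b + 1) - g (m + 1) * g b"
    using assms unfolding quadratic_rel_def by blast
  thus ?case by (simp add: algebra_simps)
next
  case (Suc j)
  define x where "x = screen_right (g b) j (g m)"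
  define c where "c = r ^ Suc j"
  have c': "r ^ Suc (Suc j) = c * r" by (simp add: c_def)
  note a = quadratic_rel_adjacent[OF assms, of b]
  have a2: "g (b + 1) * (g b * z) = sc r * (g b * (g (b + 1) * z))" for z
    by (simp only: a flip: mult.assoc)
  have "g (b + 1) * (x * g b - sc c * (g b * x)) - sc (c * r) * ((x * g b - sc c * (g b * x)) * g (b + 1))
     = (g (b + 1) * x - sc c * (x * g (b + 1))) * g b
        - sc (c * r) * (g b * (g (b + 1) * x - sc c * (x * g (b + 1))))"
    by (simp only: left_diff_distrib right_diff_distrib mult.assoc sc_left_commute[of x]
        sc_left_commute[of "g b"] sc_left_commute[of "g (b + 1)"] a a2 sc_scale)
       (simp add: ac_simps)
  also have "g (b + 1) * x - sc c * (x * g (b + 1)) = - screen_right (g b) (Suc j) (g (m + 1))"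
    unfolding x_def c_def by (rule Suc)
  also have "x * g b - sc c * (g b * x) = screen_right (g b) (Suc j) (g m)"
    by (simp only: screen_right.simps x_def c_def)
  finally show ?case
    unfolding c' screen_right.simps(2)[of _ "Suc j"] by (simp del: screen_right.simps)
qed

lemma screen_left_eq_screen_right:
  assumes "quadratic_rel g"
  shows "screen_left (g (b + 1)) j (g m) = (- 1) ^ j * screen_right (g b) j (g (m + int j))"
proof (induction j)
  case (Suc j)
  have c': "x * ((-1) ^ j * y) = (-1) ^ j * (x * y)" for x y :: 'b
    by (cases "even j") simp_all
  have "screen_left (g (b + 1)) (Suc j) (g m) = (- 1) ^ j * (g (b + 1) * screen_right (g b) j (g (m + int j))
      - sc (r ^ Suc j) * (screen_right (g b) j (g (m + int j)) * g (b + 1)))"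
    unfolding screen_left.simps Suc by (simp only: right_diff_distrib c' mult.assoc)
  also have "\<dots> = (- 1) ^ Suc j * screen_right (g b) (Suc j) (g (m + int (Suc j)))"
    unfolding screen_left_step_screen_right[OF assms] by (simp add: ac_simps del: screen_right.simps)
  finally show ?case .
qed simp

lemma screen_right_0: "screen_right b j 0 = 0"
  by (induction j) simp_all

text \<open>Only proportionality to a power of \<open>b\<close> is needed for the vanishing lemmas,
  so the constant stays unspecified.\<close>

lemma screen_right_self: "\<exists>c. screen_right b j b = sc c * b ^ Suc j"
  and screen_left_self: "\<exists>c. screen_left b j b = sc c * b ^ Suc j"
proof (induction j)
  case 0
  { case 1 show ?case by (rule exI[of _ 1]) simp next case 2 show ?case by (rule exI[of _ 1]) simp }
next
  case (Suc j)
  have pow: "b ^ Suc j * b = b ^ Suc (Suc j)" "b * b ^ Suc j = b ^ Suc (Suc j)"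
    by (simp_all only: power_Suc2[of b "Suc j"] power_commutes)
  {
    case 1
    obtain c where c: "screen_right b j b = sc c * b ^ Suc j" using Suc by blast
    have "screen_right b (Suc j) b = sc (c - r ^ Suc j * c) * b ^ Suc (Suc j)"
      by (simp only: screen_right.simps c mult.assoc sc_left_commute[of b] sc_scale pow sc_diff left_diff_distrib)
    thus ?case by blast
  next
    case 2
    obtain c where c: "screen_left b j b = sc c * b ^ Suc j" using Suc by blast
    have "screen_left b (Suc j) b = sc (c - r ^ Suc j * c) * b ^ Suc (Suc j)"
      by (simp only: screen_left.simps c mult.assoc sc_left_commute[of b] sc_scale pow sc_diff left_diff_distrib)
    thus ?case by blast
  }
qed

text \<open>After \<open>l\<close> screenings the element is, by the exchange of left and right
  screening, a multiple of \<open>g (b + 1) ^ Suc l\<close>. This commutes with \<open>g b\<close>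
  up to exactly the scalar \<open>r ^ Suc l\<close> of the next screening, which therefore gives
  0.\<close>

lemma screen_right_vanishes:
  assumes "quadratic_rel g" "l < j"
  shows "screen_right (g b) j (g (b + 1 + int l)) = 0"
proof -
  have u: "(- 1) ^ l * ((- 1) ^ l * z) = z" for z :: 'b
    by (cases "even l") simp_all
  obtain c where "screen_left (g (b + 1)) l (g (b + 1)) = sc c * g (b + 1) ^ Suc l"
    using screen_left_self by blast
  hence "(- 1) ^ l * ((- 1) ^ l * screen_right (g b) l (g (b + 1 + int l))) = (- 1) ^ l * (sc c * g (b + 1) ^ Suc l)"
    unfolding screen_left_eq_screen_right[OF assms(1)] by simp
  hence S: "screen_right (g b) l (g (b + 1 + int l)) = sc ((- 1) ^ l * c) * g (b + 1) ^ Suc l"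
    unfolding u by (cases "even l") (simp_all add: sc_minus)
  have "screen_right (g b) (Suc l) (g (b + 1 + int l)) = 0"
    by (simp only: screen_right.simps S mult.assoc quadratic_rel_power[OF assms(1)] sc_left_commute[of "g b"] sc_scale)
       (simp add: mult_ac)
  moreover have "screen_right (g b) (Suc l + d) (g (b + 1 + int l)) = 0" for d
    using calculation by (induction d) simp_all
  ultimately show ?thesis
    using assms(2) by (metis Suc_leI le_add_diff_inverse)
qed

text \<open>Mirror image: \<open>l\<close> left screenings produce a multiple of
  \<open>g b ^ Suc l\<close>, which the next one annihilates.\<close>

lemma screen_left_vanishes:
  assumes "quadratic_rel g" "l < j"
  shows "screen_left (g (b + 1)) j (g (b - int l)) = 0"
proof -
  obtain c where "screen_right (g b) l (g b) = sc c * g b ^ Suc l"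
    using screen_right_self by blast
  hence S: "screen_left (g (b + 1)) l (g (b - int l)) = sc ((- 1) ^ l * c) * g b ^ Suc l"
    unfolding screen_left_eq_screen_right[OF assms(1)] by (cases "even l") (simp_all add: sc_minus)
  have "screen_left (g (b + 1)) (Suc l) (g (b - int l)) = 0"
    by (simp only: screen_left.simps S mult.assoc quadratic_rel_power[OF assms(1)] sc_left_commute[of "g (b + 1)"] sc_scale)
       (simp add: mult_ac)
  moreover have "screen_left (g (b + 1)) (Suc l + d) (g (b - int l)) = 0" for d
    using calculation by (induction d) simp_all
  ultimately show ?thesis
    using assms(2) by (metis Suc_leI le_add_diff_inverse)
qed

subsection \<open>Bigraded series\<close>

text \<open>The mode degree is tracked by a formal variable, so that a half-current pairing becomes a
  single element of the ring of power series over the original algebra.\<close>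
interpretation fps: q_algebra q "\<lambda>c. fps_const (sc c)"
proof
  show "C_alg (\<lambda>c. fps_const (sc c))"
    unfolding C_alg_def by (auto simp: sc_add sc_mult fps_eq_iff intro: sc_central[symmetric])
qed (use q_nonzero q_generic in auto)

text \<open>The variable \<open>fps_X\<close> is central and each of the \<open>j\<close> factors
  contains it to the power \<open>a\<close>, whence the shift by \<open>j * a\<close>.\<close>

lemma fps_left_product_nth:
  "fps.left_product (fps_const f * fps_X ^ a) (fps_const e) j w $ k
    = (if k < j * a then 0 else left_product f e j (w $ (k - j * a)))"
  and fps_right_product_nth:
  "fps.right_product (fps_const f * fps_X ^ a) (fps_const e) j w $ k
    = (if k < j * a then 0 else right_product f e j (w $ (k - j * a)))"
proof (induction j arbitrary: k)
  case (Suc j)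
  have L: "(fps_const f * fps_X ^ a * fps_const e * x) $ k = (if k < a then 0 else f * e * x $ (k - a))"
    and R: "(x * (fps_const f * fps_X ^ a * fps_const e)) $ k = (if k < a then 0 else x $ (k - a) * (f * e))"
    and S: "(fps_const f * fps_X ^ a * x * fps_const e) $ k = (if k < a then 0 else f * x $ (k - a) * e)"
      "(fps_const e * x * (fps_const f * fps_X ^ a)) $ k = (if k < a then 0 else e * x $ (k - a) * f)" for x :: "'b fps" and k
  proof -
    have "fps_const f * fps_X ^ a * fps_const e * x = fps_const (f * e) * (fps_X ^ a * x)"
      by (simp add: mult.assoc fps_mult_fps_X_power_commute flip: fps_const_mult)
    thus "(fps_const f * fps_X ^ a * fps_const e * x) $ k = (if k < a then 0 else f * e * x $ (k - a))"
      by (simp add: fps_X_power_mult_nth del: fps_const_mult)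
    have "x * (fps_const f * fps_X ^ a * fps_const e) = x * fps_const (f * e) * fps_X ^ a"
      by (simp add: mult.assoc fps_mult_fps_X_power_commute flip: fps_const_mult)
    thus "(x * (fps_const f * fps_X ^ a * fps_const e)) $ k = (if k < a then 0 else x $ (k - a) * (f * e))"
      by (simp add: fps_X_power_mult_right_nth)
    have eqs: "fps_const f * fps_X ^ a * x * fps_const e = fps_const f * (fps_X ^ a * (x * fps_const e))"
      "fps_const e * x * (fps_const f * fps_X ^ a) = fps_const e * x * fps_const f * fps_X ^ a"
      by (simp_all add: mult.assoc)
    show "(fps_const f * fps_X ^ a * x * fps_const e) $ k = (if k < a then 0 else f * x $ (k - a) * e)"
      "(fps_const e * x * (fps_const f * fps_X ^ a)) $ k = (if k < a then 0 else e * x $ (k - a) * f)"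
      unfolding eqs fps_add_nth fps_X_power_mult_right_nth fps_mult_left_const_nth fps_X_power_mult_nth
        fps_mult_right_const_nth by (simp_all add: mult.assoc)
  qed
  have d: "k - a - j * a = k - Suc j * a" for k by simp
  have lt: "k - a < j * a \<longleftrightarrow> k < Suc j * a" if "\<not> k < a" for k using that by auto
  have lt': "k < a \<Longrightarrow> k < Suc j * a" for k by simp
  {
    case 1
    show ?case
      using Suc(1)[of "k - a"] lt lt'
      unfolding fps.left_product_def[of "fps_const f * fps_X ^ a"] left_product_def fps.op_product.simps op_product.simps
      by (simp only: fps_add_nth fps_sub_nth fps_mult_left_const_nth L R S d) auto
  next
    case 2
    show ?case
      using Suc(2)[of "k - a"] lt lt'
      unfolding fps.right_product_def[of "fps_const f * fps_X ^ a"] right_product_def fps.op_product.simps op_product.simps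
      by (simp only: fps_add_nth fps_sub_nth fps_mult_left_const_nth L R S d) auto
  }
qed (simp_all add: fps.left_product_def left_product_def fps.right_product_def right_product_def)

lemma cfps_qexp_factor:
  assumes "x * y = y * x"
  shows "cfps (qexp_factor sc q m x y) = fps.qexp (fps_const x * fps_X ^ m * fps_const y)"
proof (intro fps_ext)
  fix n k
  have 1: "fps_const x * fps_X ^ m * fps_const y = fps_const (x * y) * fps_X ^ m"
    by (simp add: mult.assoc fps_mult_fps_X_power_commute flip: fps_const_mult)
  have 2: "(fps_const (x * y) * fps_X ^ m) ^ n = fps_const (x ^ n * y ^ n) * fps_X ^ (n * m)" for n
  proof (induction n)
    case (Suc n)
    have "y * x ^ n = x ^ n * y" using assms by (metis power_commuting_commutes)
    hence c: "x * y * (x ^ n * y ^ n) = x ^ Suc n * y ^ Suc n"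
      by (simp add: mult.assoc) (metis mult.assoc)
    have "(fps_const (x * y) * fps_X ^ m) ^ Suc n
        = fps_const (x * y) * (fps_X ^ m * fps_const (x ^ n * y ^ n)) * fps_X ^ (n * m)"
      by (simp only: power_Suc Suc mult.assoc)
    also have "\<dots> = fps_const (x * y) * fps_const (x ^ n * y ^ n) * fps_X ^ (m + n * m)"
      by (simp only: fps_mult_fps_X_power_commute[of m "fps_const _"] mult.assoc power_add)
    finally show ?case by (simp only: fps_const_mult c mult_Suc)
  qed simp
  show "cfps (qexp_factor sc q m x y) $ n $ k
      = fps.qexp (fps_const x * fps_X ^ m * fps_const y) $ n $ k"
    unfolding fps.qexp_def cfps_nth fps_nth_Abs_fps 1 2
    by (simp add: qexp_factor_def eps_def fps_X_power_nth mult.assoc)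
qed

text \<open>The constant term of a half-current pairing, without its sign and restricted to modes of
  index at least \<open>a\<close>, with each mode marked by its degree.\<close>

definition pair_tail :: "(nat \<Rightarrow> 'b) \<Rightarrow> (nat \<Rightarrow> 'b) \<Rightarrow> nat \<Rightarrow> 'b fps" where
  "pair_tail x y a = Abs_fps (\<lambda>k. if k < a then 0 else x k * y k)"

lemma pair_tail_Suc: "pair_tail x y a = pair_tail x y (Suc a) + fps_const (x a) * fps_X ^ a * fps_const (y a)"
proof (rule fps_ext)
  fix k
  have 1: "fps_const (x a) * fps_X ^ a * fps_const (y a) = fps_const (x a * y a) * fps_X ^ a"
    by (simp add: mult.assoc fps_mult_fps_X_power_commute flip: fps_const_mult)
  show "pair_tail x y a $ k = (pair_tail x y (Suc a) + fps_const (x a) * fps_X ^ a * fps_const (y a)) $ k"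
    unfolding 1 by (auto simp: pair_tail_def fps_X_power_nth less_Suc_eq)
qed

lemma pair_tail_low: "k < a \<Longrightarrow> pair_tail x y a $ k = 0"
  by (simp add: pair_tail_def)

text \<open>The index \<open>a\<close> is the screening mode and \<open>b\<close> the first mode of
  the tail. They are kept apart because the shift lemmas move them independently.\<close>

definition left_generator :: "(nat \<Rightarrow> 'b) \<Rightarrow> (nat \<Rightarrow> 'b) \<Rightarrow> nat \<Rightarrow> nat \<Rightarrow> 'b fps fps" where
  "left_generator x y a b = fps.left_series (fps_const (x a) * fps_X ^ a) (fps_const (y a)) (pair_tail x y b)"
definition right_generator :: "(nat \<Rightarrow> 'b) \<Rightarrow> (nat \<Rightarrow> 'b) \<Rightarrow> nat \<Rightarrow> nat \<Rightarrow> 'b fps fps" where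
  "right_generator x y a b = fps.right_series (fps_const (x a) * fps_X ^ a) (fps_const (y a)) (pair_tail x y b)"

lemma left_generator_nth: "left_generator x y a b $ n $ k = (case n of 0 \<Rightarrow> 0 | Suc j \<Rightarrow>
    if k < j * a then 0 else - (sc (gam_coef j) * left_product (x a) (y a) j (pair_tail x y b $ (k - j * a))))"
  and right_generator_nth: "right_generator x y a b $ n $ k = (case n of 0 \<Rightarrow> 0 | Suc j \<Rightarrow>
    if k < j * a then 0 else - (sc (gam_coef j) * right_product (x a) (y a) j (pair_tail x y b $ (k - j * a))))"
  by (simp_all add: left_generator_def right_generator_def fps.left_series_def fps.right_series_def fps_left_product_nth fps_right_product_nth split: nat.split)

lemma generator_low:
  assumes "k < b"
  shows "left_generator x y a b $ n $ k = 0" "right_generator x y a b $ n $ k = 0"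
  using assms by (simp_all add: left_generator_nth right_generator_nth pair_tail_low less_imp_diff_less left_product_0 right_product_0 split: nat.split)

definition factor :: "(nat \<Rightarrow> 'b) \<Rightarrow> (nat \<Rightarrow> 'b) \<Rightarrow> nat \<Rightarrow> 'b fps fps" where
  "factor x y a = cfps (qexp_factor sc q a (x a) (y a))"

lemma factor_step:
  assumes "x a * y a = y a * x a"
  shows "factor x y a * left_generator x y a a = right_generator x y a (Suc a) * factor x y a + fps.theta (factor x y a)"
    and "right_generator x y a a * factor x y a = factor x y a * left_generator x y a (Suc a) + fps.theta (factor x y a)"
proof -
  have c: "fps_const (x a) * fps_X ^ a * fps_const (y a) = fps_const (y a) * (fps_const (x a) * fps_X ^ a)"
    using assms
    by (simp add: fps_mult_fps_X_power_commute mult.assoc) (simp flip: mult.assoc)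
  show "factor x y a * left_generator x y a a = right_generator x y a (Suc a) * factor x y a + fps.theta (factor x y a)"
    and "right_generator x y a a * factor x y a = factor x y a * left_generator x y a (Suc a) + fps.theta (factor x y a)"
    unfolding factor_def left_generator_def right_generator_def cfps_qexp_factor[OF assms] pair_tail_Suc[of x y a]
    by (rule fps.qexp_step_left[OF c], rule fps.qexp_step_right[OF c])
qed

text \<open>The \<open>j\<close> screenings use up mode degree \<open>j * a\<close>. The remainder
  is negative, below the tail, among the \<open>j\<close> modes killed by screening, or large enough
  to be matched by screening mode \<open>a + 1\<close>, since j(a+1) + (a+1+l) = ja +
  (a+1+j+l).\<close>

lemma shift_cases:
  obtains "k < j * a" | "j * a \<le> k" "k - j * a < Suc a"
    | l where "k = j * a + (a + 1 + l)" "l < j" | l where "k = j * a + (a + 1 + (j + l))"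
proof (cases "k < j * a + (a + 1)")
  case True thus thesis using that(1,2) by linarith
next
  case False
  define l where "l = k - (j * a + (a + 1))"
  have l: "k = j * a + (a + 1 + l)" using False by (simp add: l_def)
  show thesis
  proof (cases "l < j")
    case True thus thesis using that(3)[OF l] by simp
  next
    case False
    hence "k = j * a + (a + 1 + (j + (l - j)))" using l by simp
    thus thesis by (rule that(4))
  qed
qed

lemma sign_cancel: "(- 1) ^ j * u * ((- 1) ^ j * v) = u * (v :: 'b)"
  by (cases "even j") simp_all

text \<open>In each coefficient \<open>screen_left_eq_screen_right\<close> is applied to both tensor
  factors, and the two signs cancel. The first \<open>j\<close> modes of the tail have no
  counterpart on the left and drop out by \<open>screen_right_vanishes\<close>.\<close>

lemma generator_shift_up:
  assumes q: "quadratic_rel F" "quadratic_rel E" and c: "\<And>i j. F i * E j = E j * F i"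
    and x: "\<And>m. x m = F (int m)" and y: "\<And>m. y m = E (int m)"
  shows "left_generator x y (Suc a) (Suc a) = right_generator x y a (Suc a)"
proof (intro fps_ext)
  fix n k
  show "left_generator x y (Suc a) (Suc a) $ n $ k = right_generator x y a (Suc a) $ n $ k"
  proof (cases n)
    case (Suc j)
    consider "k < j * a" | "j * a \<le> k" "k - j * a < Suc a"
      | l where "k = j * a + (a + 1 + l)" "l < j" | l where "k = j * a + (a + 1 + (j + l))"
      by (rule shift_cases)
    thus ?thesis
    proof cases
      case 1 thus ?thesis by (simp add: Suc left_generator_nth right_generator_nth)
    next
      case 2 thus ?thesis by (simp add: Suc left_generator_nth right_generator_nth pair_tail_low right_product_0 left_product_0)
    next
      case 3
      have i: "int (a + 1 + l) = int a + 1 + int l" by simp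
      have t: "pair_tail x y (Suc a) $ (k - j * a) = F (int a + 1 + int l) * E (int a + 1 + int l)"
        unfolding i[symmetric] using 3 by (simp add: pair_tail_def x y)
      \<comment> \<open>As \<open>l < j\<close>, the left generator sees only a residual degree
        below the start of its tail.\<close>
      have lo: "k - j * Suc a < Suc a" using 3 by simp
      have "right_product (x a) (y a) j (pair_tail x y (Suc a) $ (k - j * a))
          = screen_right (F (int a)) j (F (int a + 1 + int l)) * screen_right (E (int a)) j (E (int a + 1 + int l))"
        unfolding t by (subst screen_right_mult[OF c c[symmetric] c]) (simp add: x y)
      also have "\<dots> = 0" by (simp add: screen_right_vanishes[OF q(1) 3(2)])
      finally show ?thesis
        unfolding Suc left_generator_nth right_generator_nth nat.case(2) pair_tail_low[OF lo] by (simp add: left_product_0)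
    next
      case 4
      have i: "int (a + 1 + (j + l)) = int a + 1 + int l + int j" "int (a + 1 + l) = int a + 1 + int l" by simp_all
      have t: "pair_tail x y (Suc a) $ (k - j * a) = F (int a + 1 + int l + int j) * E (int a + 1 + int l + int j)"
        unfolding i(1)[symmetric] using 4 by (simp add: pair_tail_def x y)
      have t': "pair_tail x y (Suc a) $ (k - j * Suc a) = F (int a + 1 + int l) * E (int a + 1 + int l)"
        unfolding i(2)[symmetric] using 4 by (simp add: pair_tail_def x y)
      have "right_product (x a) (y a) j (pair_tail x y (Suc a) $ (k - j * a))
          = screen_right (F (int a)) j (F (int a + 1 + int l + int j)) * screen_right (E (int a)) j (E (int a + 1 + int l + int j))"
        unfolding t by (subst screen_right_mult[OF c c[symmetric] c]) (simp add: x y)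
      also have "\<dots> = screen_left (F (int a + 1)) j (F (int a + 1 + int l)) * screen_left (E (int a + 1)) j (E (int a + 1 + int l))"
        unfolding screen_left_eq_screen_right[OF q(1)] screen_left_eq_screen_right[OF q(2)] sign_cancel ..
      also have "\<dots> = left_product (x (Suc a)) (y (Suc a)) j (pair_tail x y (Suc a) $ (k - j * Suc a))"
        unfolding t' by (subst screen_left_mult[OF c c[symmetric] c]) (simp add: x y add.commute)
      finally show ?thesis
        using 4 by (simp add: Suc left_generator_nth right_generator_nth)
    qed
  qed (simp add: left_generator_nth right_generator_nth)
qed

text \<open>Index \<open>a\<close> now stands for mode -a, so raising the index lowers the mode.
  With b = -a-1 the left screening is by mode b+1 and the right one by mode b.\<close>

lemma generator_shift_down:
  assumes q: "quadratic_rel F" "quadratic_rel E" and c: "\<And>i j. F i * E j = E j * F i"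
    and x: "\<And>m. x m = F (- int m)" and y: "\<And>m. y m = E (- int m)"
  shows "left_generator x y a (Suc a) = right_generator x y (Suc a) (Suc a)"
proof (intro fps_ext)
  fix n k
  show "left_generator x y a (Suc a) $ n $ k = right_generator x y (Suc a) (Suc a) $ n $ k"
  proof (cases n)
    case (Suc j)
    consider "k < j * a" | "j * a \<le> k" "k - j * a < Suc a"
      | l where "k = j * a + (a + 1 + l)" "l < j" | l where "k = j * a + (a + 1 + (j + l))"
      by (rule shift_cases)
    thus ?thesis
    proof cases
      case 1 thus ?thesis by (simp add: Suc left_generator_nth right_generator_nth)
    next
      case 2 thus ?thesis by (simp add: Suc left_generator_nth right_generator_nth pair_tail_low right_product_0 left_product_0)
    next
      case 3
      have i: "- int (a + 1 + l) = - int a - 1 - int l" by simp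
      have t: "pair_tail x y (Suc a) $ (k - j * a) = F (- int a - 1 - int l) * E (- int a - 1 - int l)"
        unfolding i[symmetric] using 3 by (simp add: pair_tail_def x y)
      have lo: "k - j * Suc a < Suc a" using 3 by simp
      have "left_product (x a) (y a) j (pair_tail x y (Suc a) $ (k - j * a))
          = screen_left (F (- int a - 1 + 1)) j (F (- int a - 1 - int l)) * screen_left (E (- int a - 1 + 1)) j (E (- int a - 1 - int l))"
        unfolding t by (subst screen_left_mult[OF c c[symmetric] c]) (simp add: x y)
      also have "\<dots> = 0" by (simp only: screen_left_vanishes[OF q(1) 3(2)] mult_zero_left)
      finally show ?thesis
        unfolding Suc left_generator_nth right_generator_nth nat.case(2) pair_tail_low[OF lo] by (simp add: right_product_0)
    next
      case 4
      have "- int (Suc a) = - int a - 1" by simp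
      hence xs: "x (Suc a) = F (- int a - 1)" "y (Suc a) = E (- int a - 1)" by (simp_all only: x y)
      have i: "- int (a + 1 + (j + l)) = - int a - 1 - int l - int j" "- int (a + 1 + l) = - int a - 1 - int l" by simp_all
      have t: "pair_tail x y (Suc a) $ (k - j * a) = F (- int a - 1 - int l - int j) * E (- int a - 1 - int l - int j)"
        unfolding i(1)[symmetric] using 4 by (simp add: pair_tail_def x y)
      have t': "pair_tail x y (Suc a) $ (k - j * Suc a) = F (- int a - 1 - int l) * E (- int a - 1 - int l)"
        unfolding i(2)[symmetric] using 4 by (simp add: pair_tail_def x y)
      have "left_product (x a) (y a) j (pair_tail x y (Suc a) $ (k - j * a))
          = screen_left (F (- int a - 1 + 1)) j (F (- int a - 1 - int l - int j)) *
            screen_left (E (- int a - 1 + 1)) j (E (- int a - 1 - int l - int j))"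
        unfolding t by (subst screen_left_mult[OF c c[symmetric] c]) (simp add: x y)
      also have "\<dots> = screen_right (F (- int a - 1)) j (F (- int a - 1 - int l)) * screen_right (E (- int a - 1)) j (E (- int a - 1 - int l))"
        unfolding screen_left_eq_screen_right[OF q(1)] screen_left_eq_screen_right[OF q(2)] sign_cancel by simp
      also have "\<dots> = right_product (x (Suc a)) (y (Suc a)) j (pair_tail x y (Suc a) $ (k - j * Suc a))"
        unfolding t' xs by (rule screen_right_mult[OF c c[symmetric] c])
      finally show ?thesis
        using 4 by (simp add: Suc left_generator_nth right_generator_nth)
    qed
  qed (simp add: left_generator_nth right_generator_nth)
qed

subsection \<open>The differential equations\<close>

lemma screen_right_weight:
  assumes k: "ki * k = 1" and b: "k * b * ki = sc c * b" and x: "k * x * ki = sc c * x"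
  shows "k * screen_right b j x * ki = sc (c ^ Suc j) * screen_right b j x"
proof (induction j)
  case (Suc j)
  have split: "k * (u * v) * ki = (k * u * ki) * (k * v * ki)" for u v
    using k by (metis mult.assoc mult.right_neutral)
  have "k * (screen_right b j x * b) * ki = sc (c ^ Suc (Suc j)) * (screen_right b j x * b)"
    unfolding split Suc b by (simp add: mult.assoc sc_left_commute[of "screen_right b j x"] sc_scale mult.commute)
  moreover have "k * (b * screen_right b j x) * ki = sc (c ^ Suc (Suc j)) * (b * screen_right b j x)"
    unfolding split Suc b by (simp add: mult.assoc sc_left_commute[of b] sc_scale)
  ultimately show ?case
    by (simp add: right_diff_distrib left_diff_distrib sc_left_commute[of k] mult.assoc
        sc_scale mult.commute[of "r ^ _"] del: power_Suc)
qed (use x in simp)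

lemma S_f0_funpow:
  assumes "gki G * gk G = 1" "gk G * gf G 0 * gki G = sc r * gf G 0" "gk G * x * gki G = sc r * x"
  shows "(S_f0 G ^^ j) x = screen_right (gf G 0) j x"
proof (induction j)
  case (Suc j)
  thus ?case
    using screen_right_weight[OF assms, of j]
    by (simp add: S_f0_def mult.assoc sc_left_commute[of "gf G 0"] del: power_Suc)
qed simp

text \<open>At weight p^(j+1) the screening is e_0 X - p^(j+1) X e_0, that is, -p^(j+1) times the
  step of \<open>screen_right\<close>. These factors form the product absorbed in
  \<open>gam_coef\<close>.\<close>

lemma S_e0_funpow:
  assumes "gki G * gk G = 1" "gk G * ge G 0 * gki G = sc p * ge G 0" "gk G * x * gki G = sc p * x"
  shows "(S_e0 G ^^ j) x = sc (\<Prod>i = 1..j. - (p ^ i)) * screen_right (ge G 0) j x"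
proof (induction j)
  case (Suc j)
  define X where "X = screen_right (ge G 0) j x"
  define c where "c = (\<Prod>i = 1..j. - (p ^ i))"
  have w: "gk G * X * gki G = sc (p ^ Suc j) * X"
    unfolding X_def by (rule screen_right_weight[OF assms])
  have c: "(\<Prod>i = 1..Suc j. - (p ^ i)) = c * - (p ^ Suc j)" by (simp add: c_def)
  have "(S_e0 G ^^ Suc j) x = ge G 0 * (sc c * X) - gk G * (sc c * X) * gki G * ge G 0"
    unfolding funpow.simps o_apply Suc by (simp only: S_e0_def X_def c_def)
  also have "gk G * (sc c * X) * gki G = sc (c * p ^ Suc j) * X"
    using w by (simp add: mult.assoc sc_left_commute[of "gk G"] sc_scale)
  also have "ge G 0 * (sc c * X) - sc (c * p ^ Suc j) * X * ge G 0
      = sc (c * - (p ^ Suc j)) * (X * ge G 0 - sc (r ^ Suc j) * (ge G 0 * X))"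
    using pr_power[of "Suc j"]
    by (simp add: right_diff_distrib sc_scale sc_left_commute[of "ge G 0"] mult.assoc sc_minus del: power_Suc)
  finally show ?case unfolding c by (simp add: X_def)
qed simp

lemma screen_right_minus: "screen_right b j (- x) = - screen_right b j x"
  by (induction j) simp_all

text \<open>Screening is by mode 0, while the tail starts at 1 because \<open>f_plus\<close> has no
  zero mode.\<close>

lemma cfps_I_pm:
  assumes "gki G * gk G = 1" "\<And>m. gk G * gf G m * gki G = sc r * gf G m"
    and "gki H * gk H = 1" "\<And>m. gk H * ge H m * gki H = sc p * ge H m"
    and c: "\<And>i j. gf G i * ge H j = ge H j * gf G i"
  shows "cfps (I_pm sc q G H) = right_generator (\<lambda>m. gf G (int m)) (\<lambda>m. ge H (- int m)) 0 1"
proof (intro fps_ext)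
  fix n k
  show "cfps (I_pm sc q G H) $ n $ k = right_generator (\<lambda>m. gf G (int m)) (\<lambda>m. ge H (- int m)) 0 1 $ n $ k"
  proof (cases n)
    case (Suc j)
    have f: "(S_f0 G ^^ j) (gf G (int k)) = screen_right (gf G 0) j (gf G (int k))"
      by (rule S_f0_funpow) (use assms in auto)
    have e: "(S_e0 H ^^ j) (- ge H (- int k))
        = sc (\<Prod>i = 1..j. - (p ^ i)) * screen_right (ge H 0) j (- ge H (- int k))"
      by (rule S_e0_funpow) (use assms in auto)
    have zero: "(S_f0 G ^^ j) 0 = 0"
      by (subst S_f0_funpow) (use assms in \<open>auto simp: screen_right_0\<close>)
    show ?thesis
    proof (cases "k = 0")
      case True
      thus ?thesis by (simp add: Suc I_pm_def right_generator_nth f_plus_def pair_tail_def right_product_0 zero)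
    next
      case False
      thus ?thesis
        by (simp add: Suc I_pm_def right_generator_nth f_plus_def e_minus_def pair_tail_def f e screen_right_minus gam_coef_def
            sc_left_commute[of "screen_right (gf G 0) j (gf G (int k))"] sc_scale
            flip: screen_right_mult[OF c c[symmetric] c])
    qed
  qed (simp add: I_pm_def right_generator_nth)
qed

text \<open>Here \<open>f_minus\<close> and \<open>e_plus\<close> both contain the zero mode, so the
  tail starts at 0.\<close>

lemma cfps_I_mp:
  assumes "gki G * gk G = 1" "\<And>m. gk G * gf G m * gki G = sc r * gf G m"
    and "gki H * gk H = 1" "\<And>m. gk H * ge H m * gki H = sc p * ge H m"
    and c: "\<And>i j. gf G i * ge H j = ge H j * gf G i"
  shows "cfps (I_mp sc q G H) = right_generator (\<lambda>m. gf G (- int m)) (\<lambda>m. ge H (int m)) 0 0"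
proof (intro fps_ext)
  fix n k
  show "cfps (I_mp sc q G H) $ n $ k = right_generator (\<lambda>m. gf G (- int m)) (\<lambda>m. ge H (int m)) 0 0 $ n $ k"
  proof (cases n)
    case (Suc j)
    have f: "(S_f0 G ^^ j) (- gf G (- int k)) = screen_right (gf G 0) j (- gf G (- int k))"
      by (rule S_f0_funpow) (use assms in auto)
    have e: "(S_e0 H ^^ j) (ge H (int k)) = sc (\<Prod>i = 1..j. - (p ^ i)) * screen_right (ge H 0) j (ge H (int k))"
      by (rule S_e0_funpow) (use assms in auto)
    show ?thesis
      by (simp add: Suc I_mp_def right_generator_nth f_minus_def e_plus_def pair_tail_def f e screen_right_minus gam_coef_def
          sc_left_commute[of "screen_right (gf G 0) j (gf G (- int k))"] sc_scale
          flip: screen_right_mult[OF c c[symmetric] c])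
  qed (simp add: I_mp_def right_generator_nth)
qed

lemma theta_1: "fps.theta 1 = 0"
  by (rule fps_ext) (simp add: fps.theta_def)

text \<open>A new factor is multiplied on the left, where it meets the leftover generator and moves
  it up by one mode. For \<open>M = 0\<close> the two generators coincide and cancel.\<close>

lemma theta_Rpm_part:
  assumes "quadratic_rel (gf G)" "quadratic_rel (\<lambda>i. ge H (- i))" and c: "\<And>i j. gf G i * ge H j = ge H j * gf G i"
  defines "x \<equiv> \<lambda>m. gf G (int m)" and "y \<equiv> \<lambda>m. ge H (- int m)"
  shows "fps.theta (cfps (Rpm_part sc q G H M))
    = cfps (Rpm_part sc q G H M) * right_generator x y 0 1 - right_generator x y M (Suc M) * cfps (Rpm_part sc q G H M)"
proof (induction M)
  case (Suc M)
  define P where "P = cfps (Rpm_part sc q G H M)"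
  define E where "E = factor x y (Suc M)"
  have P: "cfps (Rpm_part sc q G H (Suc M)) = E * P"
    by (simp add: P_def E_def factor_def x_def y_def cfps_cmul)
  have shift: "left_generator x y (Suc M) (Suc M) = right_generator x y M (Suc M)"
    by (rule generator_shift_up[OF assms(1,2)]) (simp_all add: c x_def y_def)
  have step: "fps.theta E = E * right_generator x y M (Suc M) - right_generator x y (Suc M) (Suc (Suc M)) * E"
    using factor_step(1)[of x "Suc M" y] unfolding E_def shift by (simp add: c x_def y_def)
  have "fps.theta (E * P) = fps.theta E * P + E * (P * right_generator x y 0 1 - right_generator x y M (Suc M) * P)"
    unfolding fps.theta_mult using Suc by (simp add: P_def)
  also have "\<dots> = E * P * right_generator x y 0 1 - right_generator x y (Suc M) (Suc (Suc M)) * (E * P)"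
    unfolding step by (simp add: algebra_simps)
  finally show ?case unfolding P .
qed (simp add: cfps_cone theta_1)

text \<open>New factors enter on the right, so the leftover generator stands there. The tail of each
  generator starts at its own screening mode.\<close>

lemma theta_Rmp_part:
  assumes "quadratic_rel (gf G)" "quadratic_rel (\<lambda>i. ge H (- i))" and c: "\<And>i j. gf G i * ge H j = ge H j * gf G i"
  defines "x \<equiv> \<lambda>m. gf G (- int m)" and "y \<equiv> \<lambda>m. ge H (int m)"
  shows "fps.theta (cfps (Rmp_part sc q G H M))
    = right_generator x y 0 0 * cfps (Rmp_part sc q G H M) - cfps (Rmp_part sc q G H M) * right_generator x y (Suc M) (Suc M)"
proof -
  have step: "fps.theta (factor x y a) = right_generator x y a a * factor x y a - factor x y a * right_generator x y (Suc a) (Suc a)" for a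
  proof -
    have "left_generator x y a (Suc a) = right_generator x y (Suc a) (Suc a)"
      by (rule generator_shift_down[OF assms(1,2)]) (simp_all add: c x_def y_def)
    thus ?thesis using factor_step(2)[of x a y] by (simp add: c x_def y_def)
  qed
  show ?thesis
  proof (induction M)
    case 0
    show ?case using step[of 0] by (simp add: factor_def x_def y_def)
  next
    case (Suc M)
    define P where "P = cfps (Rmp_part sc q G H M)"
    define E where "E = factor x y (Suc M)"
    have P: "cfps (Rmp_part sc q G H (Suc M)) = P * E"
      by (simp add: P_def E_def factor_def x_def y_def cfps_cmul)
    have "fps.theta (P * E) = (right_generator x y 0 0 * P - P * right_generator x y (Suc M) (Suc M)) * E + P * fps.theta E"
      unfolding fps.theta_mult using Suc by (simp add: P_def)
    also have "\<dots> = right_generator x y 0 0 * (P * E) - P * E * right_generator x y (Suc (Suc M)) (Suc (Suc M))"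
      unfolding E_def step by (simp add: algebra_simps)
    finally show ?case unfolding P .
  qed
qed

section \<open>Stabilisation of the infinite products\<close>

lemma qexp_factor_low: "k < m \<Longrightarrow> qexp_factor sc q m x y n k = (if n = 0 \<and> k = 0 then 1 else 0)"
  by (cases n) (auto simp: qexp_factor_def q2fact_def)

lemma sum_if_const: "(\<Sum>j\<in>A. if b then g j else 0) = (if b then sum g A else 0)"
  by simp

lemma Rpm_part_stable: "k \<le> M \<Longrightarrow> Rpm_part sc q G H M n k = R_pm sc q G H n k"
  unfolding R_pm_def
proof (induction M rule: dec_induct)
  case (step M)
  have "Rpm_part sc q G H (Suc M) n k
      = (\<Sum>i\<le>n. \<Sum>j\<le>k. if i = 0 then if j = 0 then Rpm_part sc q G H M n k else 0 else 0)"
    unfolding Rpm_part.simps cmul_def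
    by (intro sum.cong refl) (use step in \<open>simp add: qexp_factor_low\<close>)
  thus ?case using step by (simp add: sum_if_const)
qed simp

lemma Rmp_part_stable: "k \<le> M \<Longrightarrow> Rmp_part sc q G H M n k = R_mp sc q G H n k"
  unfolding R_mp_def
proof (induction M rule: dec_induct)
  case (step M)
  have "Rmp_part sc q G H (Suc M) n k
      = (\<Sum>i\<le>n. \<Sum>j\<le>k. if i = n then if j = k then Rmp_part sc q G H M n k else 0 else 0)"
    unfolding Rmp_part.simps cmul_def
    by (intro sum.cong refl) (use step in \<open>auto simp add: qexp_factor_low\<close>)
  thus ?case using step by (simp add: sum_if_const)
qed simp

lemma R_equations:
  assumes k: "gki G * gk G = 1" "\<And>m. gk G * gf G m * gki G = sc r * gf G m"
    "gki H * gk H = 1" "\<And>m. gk H * ge H m * gki H = sc p * ge H m"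
    and quadratic_rel: "quadratic_rel (gf G)" "quadratic_rel (\<lambda>i. ge H (- i))"
    and c: "\<And>i j. gf G i * ge H j = ge H j * gf G i"
  shows "sc (of_nat n) * R_pm sc q G H n k = cmul (R_pm sc q G H) (I_pm sc q G H) n k"
    and "sc (of_nat n) * R_mp sc q G H n k = cmul (I_mp sc q G H) (R_mp sc q G H) n k"
proof -
  \<comment> \<open>Truncation at \<open>M = k\<close> suffices: the leftover generator starts in
    mode degree k+1.\<close>
  have "fps.theta (cfps (Rpm_part sc q G H k)) $ n $ k
      = (cfps (Rpm_part sc q G H k) * cfps (I_pm sc q G H)) $ n $ k"
    unfolding theta_Rpm_part[OF quadratic_rel c] cfps_I_pm[OF k c]
    by (simp add: fps_fps_mult_nth[of "right_generator _ _ _ _"] generator_low)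
  thus "sc (of_nat n) * R_pm sc q G H n k = cmul (R_pm sc q G H) (I_pm sc q G H) n k"
    by (simp add: fps.theta_def fps_fps_mult_nth sc_of_nat cmul_def Rpm_part_stable fps_of_nat[symmetric])
  have "fps.theta (cfps (Rmp_part sc q G H k)) $ n $ k
      = (cfps (I_mp sc q G H) * cfps (Rmp_part sc q G H k)) $ n $ k"
    unfolding theta_Rmp_part[OF quadratic_rel c] cfps_I_mp[OF k c]
    by (simp add: fps_fps_mult_nth[of _ "right_generator _ _ _ _"] generator_low)
  thus "sc (of_nat n) * R_mp sc q G H n k = cmul (I_mp sc q G H) (R_mp sc q G H) n k"
    by (simp add: fps.theta_def fps_fps_mult_nth sc_of_nat cmul_def Rmp_part_stable fps_of_nat[symmetric])
qed

section \<open>Consequences of the defining relations\<close>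

lemma Uq_quadratic_rel:
  assumes "Uq_rels sc q G"
  shows "quadratic_rel (gf G)" "quadratic_rel (\<lambda>i. ge G (- i))"
proof -
  have "\<forall>i s. gf G (i+1) * gf G s - sc (inverse q ^ 2) * gf G i * gf G (s+1)
      = sc (inverse q ^ 2) * gf G s * gf G (i+1) - gf G (s+1) * gf G i"
    using assms unfolding Uq_rels_def Let_def by (elim conjE) assumption
  thus "quadratic_rel (gf G)" unfolding quadratic_rel_def r_def .
  have e: "\<forall>i s. ge G (i+1) * ge G s - sc (q^2) * ge G i * ge G (s+1)
      = sc (q^2) * ge G s * ge G (i+1) - ge G (s+1) * ge G i"
    using assms unfolding Uq_rels_def Let_def by (elim conjE) assumption
  show "quadratic_rel (\<lambda>i. ge G (- i))"
    unfolding quadratic_rel_def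
  proof (intro allI)
    fix i s :: int
    define A B C D where "A = ge G (- i) * ge G (- s - 1)" and "B = ge G (- i - 1) * ge G (- s)"
      and "C = ge G (- s - 1) * ge G (- i)" and "D = ge G (- s) * ge G (- i - 1)"
    \<comment> \<open>Reflecting the indices and multiplying by \<open>r\<close> turns the relation
      with \<open>p\<close> into one with \<open>r\<close>.\<close>
    have "A - sc p * B = sc p * C - D"
      using e[rule_format, of "- i - 1" "- s - 1"] by (simp add: A_def B_def C_def D_def p_def mult.assoc)
    hence "sc r * (A - sc p * B) = sc r * (sc p * C - D)" by simp
    hence "sc r * A - B = C - sc r * D"
      using pr by (simp add: right_diff_distrib sc_scale mult.commute[of r])
    hence "B - sc r * A = sc r * D - C" by (simp add: algebra_simps)
    thus "ge G (- (i + 1)) * ge G (- s) - sc r * ge G (- i) * ge G (- (s + 1))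
        = sc r * ge G (- s) * ge G (- (i + 1)) - ge G (- (s + 1)) * ge G (- i)"
      by (simp add: A_def B_def C_def D_def mult.assoc)
  qed
qed

text \<open>The relations of psi^+ with e and f at index -1 involve only psi^+_0 = k, since
  psi^+_(-1) = 0; the central power of q is then cancelled.\<close>

lemma Uq_weights:
  assumes "Uq_rels sc q G"
  shows "gki G * gk G = 1" "gk G * gf G m * gki G = sc r * gf G m" "gk G * ge G m * gki G = sc p * ge G m"
proof -
  have k: "gk G * gki G = 1" and ki: "gki G * gk G = 1" and g: "gam G * gami G = 1" "gami G * gam G = 1"
    using assms unfolding Uq_rels_def Let_def by - (elim conjE, assumption)+
  show "gki G * gk G = 1" by (rule ki)
  have e: "\<forall>i j. gam G * psip sc q G (i+1) * ge G j - sc (q^2) * psip sc q G i * ge G (j+1)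
      = sc (q^2) * gam G * ge G j * psip sc q G (i+1) - ge G (j+1) * psip sc q G i"
    using assms unfolding Uq_rels_def Let_def by (elim conjE) assumption
  have f: "\<forall>i j. gami G * psip sc q G (i+1) * gf G j - sc (inverse q ^ 2) * psip sc q G i * gf G (j+1)
      = sc (inverse q ^ 2) * gami G * gf G j * psip sc q G (i+1) - gf G (j+1) * psip sc q G i"
    using assms unfolding Uq_rels_def Let_def by (elim conjE) assumption
  have psi: "psip sc q G 0 = gk G" "psip sc q G (- 1) = 0"
    by (simp_all add: psip_def)
  have "gam G * (gk G * ge G m) = gam G * (sc p * (ge G m * gk G))"
    using e[rule_format, of "- 1" m] by (simp add: psi p_def mult.assoc sc_left_commute[of "gam G"])
  hence "gami G * gam G * (gk G * ge G m) = gami G * gam G * (sc p * (ge G m * gk G))"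
    by (simp add: mult.assoc)
  hence "gk G * ge G m = sc p * (ge G m * gk G)" by (simp add: g)
  thus "gk G * ge G m * gki G = sc p * ge G m" by (simp add: mult.assoc k)
  have "gami G * (gk G * gf G m) = gami G * (sc r * (gf G m * gk G))"
    using f[rule_format, of "- 1" m] by (simp add: psi r_def mult.assoc sc_left_commute[of "gami G"])
  hence "gam G * gami G * (gk G * gf G m) = gam G * gami G * (sc r * (gf G m * gk G))"
    by (simp add: mult.assoc)
  hence "gk G * gf G m = sc r * (gf G m * gk G)" by (simp add: g)
  thus "gk G * gf G m * gki G = sc r * gf G m" by (simp add: mult.assoc k)
qed

end

theorem theorem1:
  fixes q :: complex and sc :: "complex \<Rightarrow> 'b::ring_1" and G H :: "'b gens"
  assumes "q \<noteq> 0" and "\<forall>N::int. N \<noteq> 0 \<longrightarrow> q powi N \<noteq> 1"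
    and "C_alg sc"
    and "Uq_rels sc q G" and "Uq_rels sc q H" and "gens_commute G H"
  shows "(\<forall>n k. sc (of_nat n) * R_pm sc q G H n k = cmul (R_pm sc q G H) (I_pm sc q G H) n k)
    \<and> (\<forall>n k. sc (of_nat n) * R_mp sc q G H n k = cmul (I_mp sc q G H) (R_mp sc q G H) n k)"
proof -
  interpret q_algebra q sc
  proof
    show "q ^ (2 * n) \<noteq> 1" if "0 < n" for n
      using assms(2)[rule_format, of "int (2 * n)"] that by (simp only: power_int_of_nat) simp
  qed (use assms in auto)
  have c: "gf G i * ge H j = ge H j * gf G i" for i j
    using assms(6) unfolding gens_commute_def Let_def by blast
  show ?thesis
    using R_equations[OF Uq_weights(1,2)[OF assms(4)] Uq_weights(1,3)[OF assms(5)]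
        Uq_quadratic_rel(1)[OF assms(4)] Uq_quadratic_rel(2)[OF assms(5)] c]
    by blast
qed

end
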